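(* Let $(T,\Sigma,\mu)$ be a non-atomic, $\sigma$-finite measure space, $\Phi$ a Musielak--Orlicz function on $T$, and $u\in L_0^\Phi\setminus\{0\}$ such that $K(u)=\emptyset$. Then $u$ is a smooth point of $L_0^\Phi$ if and only if (i) $I_{\Phi^*}(b_{\Phi^*}\chi_{\operatorname{supp}u})=1$ and $a_{\Phi^*}\chi_{T\setminus\operatorname{supp}u}=0$, or (ii) $I_{\Phi^*}(b_{\Phi^*})<1$ and $\mu(T\setminus\operatorname{supp}u)=0$.
   Context: A function $\Phi\colon T\times[0,\infty]\to[0,\infty]$ is a Musielak--Orlicz function if, for $\mu$-a.e. $t\in T$: (i) $\Phi(t,\cdot)$ is convex and lower semi-continuous; (ii) $\Phi(t,0)=\lim_{u\downarrow0}\Phi(t,u)=0$ and $\Phi(t,\infty)=\infty$; and (iii) $\Phi(\cdot,u)$ is measurable for all $u\ge0$. The complementary function is $\Phi^*(t,v)=\sup_{u>0}(uv-\Phi(t,u))$, $v\ge0$; it is again a Musielak--Orlicz function. $a_{\Phi^*}(t)=\sup\{v\ge0:\Phi^*(t,v)=0\}$ and $b_{\Phi^*}(t)=\sup\{v\ge0:\Phi^*(t,v)<\infty\}$. $\operatorname{supp}u=\{t\in T:|u(t)|>0\}$ and $\chi_A$ is the indicator function of $A$ (with $\infty\cdot0=0$). Equalities of functions are $\mu$-a.e. $L^0$ is the space of real-valued measurable functions on $T$ (equality $\mu$-a.e.), $I_\Phi(u)=\int_T\Phi(t,|u(t)|)\,d\mu$ (also for $[0,\infty]$-valued measurable functions),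 $L^\Phi=\{u\in L^0: I_\Phi(\lambda u)<\infty\text{ for some }\lambda>0\}$, $\tilde L^\Phi=\{u\in L^0:I_\Phi(u)<\infty\}$. The Orlicz norm is $\|u\|_{\Phi,0}=\sup\{|\int_T uv\,d\mu|: v\in\tilde L^{\Phi^*},\ I_{\Phi^*}(v)\le1\}$, and it coincides on $L^\Phi$ with the Amemiya norm $\inf_{k>0}\frac1k(1+I_\Phi(ku))$. $L_0^\Phi$ is the Banach space $L^\Phi$ with the norm $\|\cdot\|_{\Phi,0}$. $K(u)$ is the set of all $k>0$ at which the infimum $\inf_{k>0}\frac1k(1+I_\Phi(ku))$ is attained. A support functional at $u\ne0$ is an $f\in(L_0^\Phi)^*$ with $\|f\|=1$ (dual norm with respect to $\|\cdot\|_{\Phi,0}$) and $f(u)=\|u\|_{\Phi,0}$; $u\neq 0$ is a smooth point if it has exactly one support functional. *)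

theory Defs
  imports "HOL-Analysis.Analysis"
begin

definition non_atomic :: "'a measure \<Rightarrow> bool" where
  "non_atomic M \<longleftrightarrow>
     (\<forall>A\<in>sets M. emeasure M A > 0 \<longrightarrow>
        (\<exists>B\<in>sets M. B \<subseteq> A \<and> 0 < emeasure M B \<and> emeasure M B < emeasure M A))"

text \<open>\<^const>\<open>convex_on\<close> needs a real vector space, so convexity on the extended half-line
  is spelled out here; the convention \<open>0 * \<infinity> = 0\<close> of \<^typ>\<open>ennreal\<close> applies.\<close>

definition ennreal_convex :: "(ennreal \<Rightarrow> ennreal) \<Rightarrow> bool" where
  "ennreal_convex f \<longleftrightarrow>
     (\<forall>x y. \<forall>l\<in>{0..1::real}.
        f (ennreal l * x + ennreal (1 - l) * y) \<le> ennreal l * f x + ennreal (1 - l) * f y)"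

definition lower_semicontinuous :: "(ennreal \<Rightarrow> ennreal) \<Rightarrow> bool" where
  "lower_semicontinuous f \<longleftrightarrow> (\<forall>x. f x \<le> Liminf (at x) f)"

definition musielak_orlicz :: "'a measure \<Rightarrow> ('a \<Rightarrow> ennreal \<Rightarrow> ennreal) \<Rightarrow> bool" where
  "musielak_orlicz M \<Phi> \<longleftrightarrow>
     (AE t in M. ennreal_convex (\<Phi> t) \<and> lower_semicontinuous (\<Phi> t)
        \<and> \<Phi> t 0 = 0 \<and> (\<Phi> t \<longlongrightarrow> 0) (at_right 0) \<and> \<Phi> t \<infinity> = \<infinity>)
     \<and> (\<forall>u. (\<lambda>t. \<Phi> t u) \<in> borel_measurable M)"

text \<open>The supremum runs over finite \<open>u\<close>, which avoids \<open>\<infinity> - \<infinity>\<close> for finite \<open>v\<close>.  Subtraction on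
  \<^typ>\<open>ennreal\<close> is truncated at 0; this does not change the supremum, which is nonnegative
  because \<open>\<Phi> t u\<close> tends to 0 as \<open>u\<close> decreases to 0.\<close>

definition complementary :: "('a \<Rightarrow> ennreal \<Rightarrow> ennreal) \<Rightarrow> 'a \<Rightarrow> ennreal \<Rightarrow> ennreal" where
  "complementary \<Phi> t v = (SUP u\<in>{0<..<\<infinity>}. u * v - \<Phi> t u)"

definition a_fun :: "('a \<Rightarrow> ennreal \<Rightarrow> ennreal) \<Rightarrow> 'a \<Rightarrow> ennreal" where
  "a_fun \<Phi> t = Sup {v. \<Phi> t v = 0}"

definition b_fun :: "('a \<Rightarrow> ennreal \<Rightarrow> ennreal) \<Rightarrow> 'a \<Rightarrow> ennreal" where
  "b_fun \<Phi> t = Sup {v. \<Phi> t v < \<infinity>}"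

definition supp :: "'a measure \<Rightarrow> ('a \<Rightarrow> real) \<Rightarrow> 'a set" where
  "supp M u = {t\<in>space M. \<bar>u t\<bar> > 0}"

definition modular :: "'a measure \<Rightarrow> ('a \<Rightarrow> ennreal \<Rightarrow> ennreal) \<Rightarrow> ('a \<Rightarrow> ennreal) \<Rightarrow> ennreal" where
  "modular M \<Phi> w = (\<integral>\<^sup>+t. \<Phi> t (w t) \<partial>M)"

definition modular_real :: "'a measure \<Rightarrow> ('a \<Rightarrow> ennreal \<Rightarrow> ennreal) \<Rightarrow> ('a \<Rightarrow> real) \<Rightarrow> ennreal" where
  "modular_real M \<Phi> u = modular M \<Phi> (\<lambda>t. ennreal \<bar>u t\<bar>)"

text \<open>Elements of the function spaces are represented by functions rather than by classes modulo
  null sets.\<close>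

definition L_space :: "'a measure \<Rightarrow> ('a \<Rightarrow> ennreal \<Rightarrow> ennreal) \<Rightarrow> ('a \<Rightarrow> real) set" where
  "L_space M \<Phi> =
     {u \<in> borel_measurable M. \<exists>c>0. modular_real M \<Phi> (\<lambda>t. c * u t) < \<infinity>}"

definition L_class :: "'a measure \<Rightarrow> ('a \<Rightarrow> ennreal \<Rightarrow> ennreal) \<Rightarrow> ('a \<Rightarrow> real) set" where
  "L_class M \<Phi> = {u \<in> borel_measurable M. modular_real M \<Phi> u < \<infinity>}"

text \<open>For \<open>u\<close> in \<open>L_space M \<Phi>\<close> the set below is bounded and contains 0 (Young's inequality), so
  the real-valued supremum and the Bochner integrals are the intended ones.\<close>

definition orlicz_norm :: "'a measure \<Rightarrow> ('a \<Rightarrow> ennreal \<Rightarrow> ennreal) \<Rightarrow> ('a \<Rightarrow> real) \<Rightarrow> real" where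
  "orlicz_norm M \<Phi> u =
     (SUP v\<in>{v \<in> L_class M (complementary \<Phi>). modular_real M (complementary \<Phi>) v \<le> 1}.
        \<bar>LINT t|M. u t * v t\<bar>)"

definition amemiya :: "'a measure \<Rightarrow> ('a \<Rightarrow> ennreal \<Rightarrow> ennreal) \<Rightarrow> ('a \<Rightarrow> real) \<Rightarrow> real \<Rightarrow> ennreal" where
  "amemiya M \<Phi> u k = ennreal (1 / k) * (1 + modular_real M \<Phi> (\<lambda>t. k * u t))"

definition K_set :: "'a measure \<Rightarrow> ('a \<Rightarrow> ennreal \<Rightarrow> ennreal) \<Rightarrow> ('a \<Rightarrow> real) \<Rightarrow> real set" where
  "K_set M \<Phi> u = {k. k > 0 \<and> amemiya M \<Phi> u k = (INF l\<in>{0<..}. amemiya M \<Phi> u l)}"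

text \<open>Boundedness forces a functional to agree on functions that are equal almost everywhere, so
  these are exactly the functionals on the quotient.  Extensionality makes a functional determined
  by its values on \<open>L_space M \<Phi>\<close>.\<close>

definition dual_space ::
    "'a measure \<Rightarrow> ('a \<Rightarrow> ennreal \<Rightarrow> ennreal) \<Rightarrow> (('a \<Rightarrow> real) \<Rightarrow> real) set" where
  "dual_space M \<Phi> =
     {f \<in> extensional (L_space M \<Phi>).
        (\<forall>x\<in>L_space M \<Phi>. \<forall>y\<in>L_space M \<Phi>. f (\<lambda>t. x t + y t) = f x + f y)
      \<and> (\<forall>c. \<forall>x\<in>L_space M \<Phi>. f (\<lambda>t. c * x t) = c * f x)
      \<and> (\<exists>C. \<forall>x\<in>L_space M \<Phi>. \<bar>f x\<bar> \<le> C * orlicz_norm M \<Phi> x)}"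

definition dual_norm ::
    "'a measure \<Rightarrow> ('a \<Rightarrow> ennreal \<Rightarrow> ennreal) \<Rightarrow> (('a \<Rightarrow> real) \<Rightarrow> real) \<Rightarrow> real" where
  "dual_norm M \<Phi> f = (SUP x\<in>{x \<in> L_space M \<Phi>. orlicz_norm M \<Phi> x \<le> 1}. \<bar>f x\<bar>)"

definition support_functional ::
    "'a measure \<Rightarrow> ('a \<Rightarrow> ennreal \<Rightarrow> ennreal) \<Rightarrow> ('a \<Rightarrow> real) \<Rightarrow> (('a \<Rightarrow> real) \<Rightarrow> real) \<Rightarrow> bool" where
  "support_functional M \<Phi> u f \<longleftrightarrow>
     f \<in> dual_space M \<Phi> \<and> dual_norm M \<Phi> f = 1 \<and> f u = orlicz_norm M \<Phi> u"

definition nonzero_element ::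
    "'a measure \<Rightarrow> ('a \<Rightarrow> ennreal \<Rightarrow> ennreal) \<Rightarrow> ('a \<Rightarrow> real) \<Rightarrow> bool" where
  "nonzero_element M \<Phi> u \<longleftrightarrow> u \<in> L_space M \<Phi> \<and> \<not> (AE t in M. u t = 0)"

definition smooth_point ::
    "'a measure \<Rightarrow> ('a \<Rightarrow> ennreal \<Rightarrow> ennreal) \<Rightarrow> ('a \<Rightarrow> real) \<Rightarrow> bool" where
  "smooth_point M \<Phi> u \<longleftrightarrow> nonzero_element M \<Phi> u \<and> (\<exists>!f. support_functional M \<Phi> u f)"

end

theory Submission
  imports Defs
begin

text \<open>Write \<open>b = b\<^bsub>\<Phi>*\<^esub>\<close> and \<open>S = supp u\<close>.  Since \<open>K(u)\<close> is empty, a compactness argument forces the Amemiya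
  infimum to be approached only as \<open>k \<rightarrow> \<infinity>\<close>, hence \<open>\<parallel>u\<parallel> = \<integral> b |u|\<close> and \<open>I\<^bsub>\<Phi>*\<^esub>(b \<chi>\<^sub>S) \<le> 1\<close>, and integration
  against \<open>v\<^sub>0 = sgn u \<sqdot> b \<chi>\<^sub>S\<close> is a support functional.  If \<open>f\<close> is any support functional and \<open>I\<^bsub>\<Phi>\<^esub>(c x) < \<infinity>\<close>,
  the Amemiya bound gives \<open>n \<parallel>u\<parallel> + c f(x) = f(n u + c x) \<le> 1 + I\<^bsub>\<Phi>\<^esub>(n u + c x)\<close>; letting \<open>n \<rightarrow> \<infinity>\<close>,
  \<open>f(x) \<le> \<integral> x v\<^sub>0 + (1 - I\<^bsub>\<Phi>*\<^esub>(b \<chi>\<^sub>S)) / c + c\<^sup>-\<^sup>1 \<integral>\<^bsub>T - S\<^esub> \<Phi>(t, c |x|)\<close>.  In case (i) let \<open>c \<rightarrow> 0\<close>, in case (ii)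
  let \<open>c \<rightarrow> \<infinity>\<close>.  Conversely, if both conditions fail, then \<open>v\<^sub>0\<close> can be perturbed off \<open>S\<close> without its
  modular exceeding 1, which yields a second support functional; singular functionals never enter.\<close>

subsection \<open>Pointwise properties of Orlicz functions and their conjugates\<close>

definition orlicz_function :: "(ennreal \<Rightarrow> ennreal) \<Rightarrow> bool" where
  "orlicz_function \<phi> \<longleftrightarrow> ennreal_convex \<phi> \<and> lower_semicontinuous \<phi>
     \<and> \<phi> 0 = 0 \<and> (\<phi> \<longlongrightarrow> 0) (at_right 0) \<and> \<phi> \<infinity> = \<infinity>"

lemma orlicz_function_0 [simp]: "orlicz_function \<phi> \<Longrightarrow> \<phi> 0 = 0"
  by (simp add: orlicz_function_def)

text \<open>Convexity between \<open>x\<close> and the origin, where \<phi> vanishes.\<close>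

lemma orlicz_function_scale:
  assumes "orlicz_function \<phi>" "0 \<le> l" "l \<le> 1"
  shows "\<phi> (ennreal l * x) \<le> ennreal l * \<phi> x"
proof -
  have "\<phi> (ennreal l * x + ennreal (1 - l) * 0) \<le> ennreal l * \<phi> x + ennreal (1 - l) * \<phi> 0"
    using assms unfolding orlicz_function_def ennreal_convex_def by (metis atLeastAtMost_iff)
  then show ?thesis using assms by simp
qed

text \<open>A finite \<open>y\<close> is scaled down to \<open>x\<close> by a factor in
  \<open>[0,1]\<close>, and scaling down does not increase the value; at \<open>\<infinity>\<close>
  the value is already the largest possible.\<close>

lemma orlicz_function_mono:
  assumes "orlicz_function \<phi>" "x \<le> y"
  shows "\<phi> x \<le> \<phi> y"
proof (cases y)
  case (real r)
  then obtain s where s: "x = ennreal s" "0 \<le> s" "s \<le> r"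
    using assms(2) by (cases x) (auto simp: ennreal_le_iff2 top_unique)
  show ?thesis
  proof (cases "r = 0")
    case False
    have "x = ennreal (s / r) * y"
      using s real False by (simp add: ennreal_mult[symmetric])
    then have "\<phi> x \<le> ennreal (s / r) * \<phi> y"
      using orlicz_function_scale[OF assms(1), of "s / r" y] s False real by (simp add: field_simps)
    also have "\<dots> \<le> 1 * \<phi> y"
      by (rule mult_right_mono) (use s False in \<open>auto simp: ennreal_le_1 divide_le_eq\<close>)
    finally show ?thesis by simp
  qed (use s real in auto)
next
  case top
  then show ?thesis using assms unfolding orlicz_function_def by simp
qed

text \<open>Lower semicontinuity keeps \<phi> above \<open>c\<close> on a left neighbourhood of
  \<open>x\<close>, where rationals are dense. The point \<open>x = \<infinity>\<close> is allowed,
  so this also controls growth at infinity.\<close>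

lemma orlicz_function_left_approx:
  assumes "orlicz_function \<phi>" "c < \<phi> x"
  obtains q :: rat where "0 < q" "ennreal (of_rat q) < x" "c < \<phi> (ennreal (of_rat q))"
proof -
  have "c < Liminf (at x) \<phi>"
    using assms unfolding orlicz_function_def lower_semicontinuous_def by (meson less_le_trans)
  then have ev: "eventually (\<lambda>y. c < \<phi> y) (at x)"
    by (rule less_LiminfD)
  have x0: "0 < x" using assms by (metis not_gr_zero orlicz_function_0 not_less_zero)
  have "eventually (\<lambda>y. c < \<phi> y) (at_left x)"
    using ev by (metis at_le filter_leD subset_UNIV)
  then obtain d where d: "d < x" "\<And>y. d < y \<Longrightarrow> y < x \<Longrightarrow> c < \<phi> y"
    using eventually_at_left[OF x0] by metis
  obtain q :: rat where q: "d < ennreal (of_rat q)" "ennreal (of_rat q) < x"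
    using d(1) ennreal_rat_dense[of d x] by metis
  have "0 < q"
    using q(1) by (metis ennreal_neg not_le not_less_zero of_rat_le_0_iff)
  then show ?thesis using that q d by blast
qed

text \<open>Only the points \<open>1 / Suc n\<close> occur, so that
  \<open>exists_pos_small_modular\<close> can choose a least index measurably.\<close>

lemma orlicz_function_small:
  assumes "orlicz_function \<phi>" "0 < e"
  shows "\<exists>n::nat. \<phi> (ennreal (1 / Suc n)) \<le> e"
proof -
  have "eventually (\<lambda>y. \<phi> y < e) (at_right 0)"
    using assms unfolding orlicz_function_def by (auto intro: order_tendstoD)
  then obtain d where d: "0 < d" "\<And>y. 0 < y \<Longrightarrow> y < d \<Longrightarrow> \<phi> y < e"
    using eventually_at_right[of "0::ennreal" 1] by auto
  obtain r where r: "0 < r" "ennreal r < d"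
    using d(1) by (metis ennreal_rat_dense ennreal_less_zero_iff)
  obtain n where "1 / real (Suc n) < r" using r(1) nat_approx_posE by blast
  then have "ennreal (1 / Suc n) < d"
    using r by (meson ennreal_leI less_imp_le order.strict_trans1)
  then show ?thesis using d(2)[of "ennreal (1 / Suc n)"] by (auto intro!: exI[of _ n] less_imp_le)
qed

text \<open>Left approximation at \<open>\<infinity>\<close>, where the value is infinite.\<close>

lemma orlicz_function_unbounded:
  assumes "orlicz_function \<phi>" "c < \<infinity>"
  obtains r :: real where "0 < r" "c < \<phi> (ennreal r)"
proof -
  have "c < \<phi> \<infinity>" using assms by (simp add: orlicz_function_def)
  then obtain q :: rat where "0 < q" "c < \<phi> (ennreal (of_rat q))"
    by (rule orlicz_function_left_approx[OF assms(1)]) auto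
  then show ?thesis using that[of "of_rat q"] by auto
qed

text \<open>This countable supremum turns measurability of \<open>\<Phi> t c\<close> in
  \<open>t\<close>, for constants \<open>c\<close>, into measurability of
  \<open>\<Phi> t (w t)\<close>.\<close>

lemma orlicz_function_eq_SUP:
  assumes "orlicz_function \<phi>"
  shows "\<phi> x = (SUP q::rat. if ennreal (of_rat q) < x then \<phi> (ennreal (of_rat q)) else 0)"
proof (rule antisym)
  show "\<phi> x \<le> (SUP q::rat. if ennreal (of_rat q) < x then \<phi> (ennreal (of_rat q)) else 0)"
  proof (rule dense_le)
    fix c assume "c < \<phi> x"
    then obtain q :: rat where "ennreal (of_rat q) < x" "c < \<phi> (ennreal (of_rat q))"
      by (rule orlicz_function_left_approx[OF assms])
    then show "c \<le> (SUP q::rat. if ennreal (of_rat q) < x then \<phi> (ennreal (of_rat q)) else 0)"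
      by (intro SUP_upper2[of q]) auto
  qed
qed (rule SUP_least, auto intro: orlicz_function_mono[OF assms])

text \<open>By convexity the slope of the chord from the origin increases; the scaling factor is
  \<open>k / l\<close>.\<close>

lemma orlicz_function_quotient_mono:
  assumes "orlicz_function \<phi>" "0 < k" "k \<le> l"
  shows "ennreal (1 / k) * \<phi> (ennreal k * x) \<le> ennreal (1 / l) * \<phi> (ennreal l * x)"
proof -
  have "ennreal k * x = ennreal (k / l) * (ennreal l * x)"
    using assms by (simp add: ennreal_mult[symmetric] mult.assoc[symmetric])
  then have "\<phi> (ennreal k * x) \<le> ennreal (k / l) * \<phi> (ennreal l * x)"
    using orlicz_function_scale[OF assms(1), of "k / l" "ennreal l * x"] assms by simp
  then have "ennreal (1 / k) * \<phi> (ennreal k * x)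
      \<le> ennreal (1 / k) * (ennreal (k / l) * \<phi> (ennreal l * x))"
    by (rule mult_left_mono) simp
  also have "\<dots> = ennreal (1 / l) * \<phi> (ennreal l * x)"
    using assms by (simp add: ennreal_mult[symmetric] mult.assoc[symmetric])
  finally show ?thesis .
qed

section \<open>Young's inequality and the conjugate function\<close>

lemma young_inequality:
  assumes "x < \<infinity>"
  shows "x * y \<le> \<Phi> t x + complementary \<Phi> t y"
proof (cases "x = 0")
  case False
  then have "x * y - \<Phi> t x \<le> complementary \<Phi> t y"
    unfolding complementary_def using assms by (intro SUP_upper) (auto simp: zero_less_iff_neq_zero)
  then show ?thesis
    by (cases "\<Phi> t x = \<infinity>") (auto simp: ennreal_minus_le_iff)
qed auto

lemma complementary_mono: "x \<le> y \<Longrightarrow> complementary \<Phi> t x \<le> complementary \<Phi> t y"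
  unfolding complementary_def
  by (intro SUP_mono') (auto intro!: ennreal_minus_mono mult_left_mono)

lemma complementary_0 [simp]: "complementary \<Phi> t 0 = 0"
  unfolding complementary_def by (auto simp: SUP_eq_const bot_ennreal)

text \<open>\<open>y\<close> has to be finite because \<open>\<infinity> - \<infinity> = \<infinity>\<close> in \<^typ>\<open>ennreal\<close>.\<close>

lemma complementary_le_iff:
  assumes "y < \<infinity>"
  shows "complementary \<Phi> t y \<le> c \<longleftrightarrow> (\<forall>r>0. ennreal r * y \<le> \<Phi> t (ennreal r) + c)"
proof
  assume *: "complementary \<Phi> t y \<le> c"
  show "\<forall>r>0. ennreal r * y \<le> \<Phi> t (ennreal r) + c"
  proof (intro allI impI)
    fix r :: real
    show "ennreal r * y \<le> \<Phi> t (ennreal r) + c"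
      using order.trans[OF young_inequality add_left_mono[OF *, of "\<Phi> t (ennreal r)"]] by simp
  qed
next
  assume *: "\<forall>r>0. ennreal r * y \<le> \<Phi> t (ennreal r) + c"
  show "complementary \<Phi> t y \<le> c"
    unfolding complementary_def
  proof (rule SUP_least)
    fix x :: ennreal assume "x \<in> {0<..<\<infinity>}"
    then obtain r where "x = ennreal r" "0 < r" by (cases x) (auto simp: ennreal_less_zero_iff)
    then show "x * y - \<Phi> t x \<le> c"
      using * assms by (auto simp: ennreal_minus_le_iff ennreal_mult_eq_top_iff)
  qed
qed

text \<open>A countable supremum makes the conjugate measurable. For infinite \<open>y\<close> both
  sides are infinite already at the point \<open>1\<close>, whatever \<open>\<Phi> t 1\<close>
  is.\<close>

lemma complementary_eq_SUP:
  assumes "orlicz_function (\<Phi> t)"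
  shows "complementary \<Phi> t y
    = (SUP q::rat. ennreal (of_rat q) * y - \<Phi> t (ennreal (of_rat q)))" (is "_ = ?R")
proof (cases "y = \<infinity>")
  case True
  have "\<infinity> \<le> complementary \<Phi> t y"
    unfolding complementary_def by (intro SUP_upper2[of 1]) (auto simp: True)
  moreover have "\<infinity> \<le> ?R"
    by (intro SUP_upper2[of 1]) (auto simp: True)
  ultimately show ?thesis by (metis infinity_ennreal_def top_unique)
next
  case False
  show ?thesis
  proof (rule antisym)
  show "complementary \<Phi> t y \<le> ?R"
    unfolding complementary_def
  proof (rule SUP_least)
    fix x :: ennreal assume x: "x \<in> {0<..<\<infinity>}"
    show "x * y - \<Phi> t x \<le> ?R"
    proof (rule dense_le)
      fix c assume c: "c < x * y - \<Phi> t x"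
      then have fin: "\<Phi> t x < \<infinity>"
        using x False by (auto simp: less_top[symmetric] minus_top_ennreal ennreal_mult_eq_top_iff split: if_splits)
      have "\<Phi> t x + c < x * y"
        using c fin less_diff_eq_ennreal[of "x * y" "\<Phi> t x" c] by (simp add: add.commute)
      \<comment> \<open>Multiplication is continuous from the left, so \<open>x\<close> can be
        lowered to \<open>z\<close>, and then to a rational in between, with the product still above
        \<open>\<Phi> t x + c\<close>; lowering the argument does not increase
        \<open>\<Phi> t\<close>.\<close>
      moreover have "(SUP z\<in>{..<x}. z * y) = x * y"
        by (simp only: SUP_mult_right_ennreal[symmetric] image_ident Sup_lessThan)
      ultimately have "\<Phi> t x + c < (SUP z\<in>{..<x}. z * y)" by metis
      then obtain z where z: "z < x" "\<Phi> t x + c < z * y" unfolding less_SUP_iff by auto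
      obtain q :: rat where q: "z < ennreal (of_rat q)" "ennreal (of_rat q) < x"
        using ennreal_rat_dense[OF z(1)] by metis
      have "\<Phi> t (ennreal (of_rat q)) + c \<le> \<Phi> t x + c"
        using q by (intro add_right_mono orlicz_function_mono[OF assms]) simp
      also have "\<dots> \<le> ennreal (of_rat q) * y"
        using z(2) q(1) by (meson less_imp_le mult_right_mono order.trans zero_le)
      finally have "c \<le> ennreal (of_rat q) * y - \<Phi> t (ennreal (of_rat q))"
        using fin q orlicz_function_mono[OF assms, of "ennreal (of_rat q)" x]
        by (intro ennreal_le_minus_iff[THEN iffD2]) (auto simp: add.commute)
      then show "c \<le> ?R" by (rule SUP_upper2[OF UNIV_I])
    qed
  qed
  show "?R \<le> complementary \<Phi> t y"
  proof (rule SUP_least)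
    fix q :: rat
    show "ennreal (of_rat q) * y - \<Phi> t (ennreal (of_rat q)) \<le> complementary \<Phi> t y"
    \<comment> \<open>\<open>ennreal\<close> sends a nonpositive rational to \<open>0\<close>, whose
      term is \<open>0\<close>.\<close>
    proof (cases "0 < q")
      case True then show ?thesis unfolding complementary_def
        by (intro SUP_upper) (auto simp: ennreal_less_zero_iff)
    qed (simp add: ennreal_neg assms)
  qed
  qed
qed

section \<open>The thresholds of the conjugate as slopes of the Orlicz function\<close>

lemma le_b_fun: "complementary \<Phi> t v < \<infinity> \<Longrightarrow> v \<le> b_fun (complementary \<Phi>) t"
  unfolding b_fun_def by (auto intro: Sup_upper)

lemma complementary_finite_below_b_fun:
  assumes "v < b_fun (complementary \<Phi>) t"
  shows "complementary \<Phi> t v < \<infinity>"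
proof -
  obtain w where "v < w" "complementary \<Phi> t w < \<infinity>"
    using assms unfolding b_fun_def less_Sup_iff by auto
  then show ?thesis using complementary_mono[of v w \<Phi> t] by (metis less_imp_le order.strict_trans1)
qed

lemma le_a_fun: "complementary \<Phi> t v = 0 \<Longrightarrow> v \<le> a_fun (complementary \<Phi>) t"
  unfolding a_fun_def by (auto intro: Sup_upper)

lemma complementary_zero_below_a_fun:
  assumes "v < a_fun (complementary \<Phi>) t"
  shows "complementary \<Phi> t v = 0"
proof -
  obtain w where "v < w" "complementary \<Phi> t w = 0"
    using assms unfolding a_fun_def less_Sup_iff by auto
  then show ?thesis using complementary_mono[of v w \<Phi> t] by simp
qed

text \<open>Take \<open>r\<close> with \<open>\<Phi> t r > 1\<close>. If
  \<open>v \<le> 1 / r\<close>, arguments up to \<open>r\<close> contribute at most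
  \<open>r * v\<close>; beyond \<open>r\<close> the chord slopes exceed \<open>1 / r\<close>, so
  nothing is contributed there.\<close>

lemma complementary_linear_near_0:
  assumes "orlicz_function (\<Phi> t)"
  obtains r :: real where "0 < r"
    "\<And>v. v \<le> ennreal (1 / r) \<Longrightarrow> complementary \<Phi> t v \<le> ennreal r * v"
proof -
  obtain r :: real where r: "0 < r" "1 < \<Phi> t (ennreal r)"
    using orlicz_function_unbounded[OF assms, of 1] by auto
  have "complementary \<Phi> t v \<le> ennreal r * v" if v: "v \<le> ennreal (1 / r)" for v
  proof -
    have "ennreal x * v \<le> \<Phi> t (ennreal x) + ennreal r * v" if "0 < x" for x
    proof (cases "x \<le> r")
      case True
      then have "ennreal x * v \<le> ennreal r * v" by (intro mult_right_mono ennreal_leI) auto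
      then show ?thesis by (simp add: add_increasing)
    next
      case False
      then have "ennreal (1 / r) * \<Phi> t (ennreal r) \<le> ennreal (1 / x) * \<Phi> t (ennreal x)"
        using orlicz_function_quotient_mono[OF assms r(1), of x 1] by simp
      moreover have "v \<le> ennreal (1 / r) * \<Phi> t (ennreal r)"
        using mult_left_mono[of 1 "\<Phi> t (ennreal r)" "ennreal (1 / r)"] r v
        by (metis less_imp_le mult.right_neutral order.trans zero_le)
      ultimately have "ennreal x * v \<le> ennreal x * (ennreal (1 / x) * \<Phi> t (ennreal x))"
        by (intro mult_left_mono) auto
      also have "\<dots> = \<Phi> t (ennreal x)"
        using \<open>0 < x\<close> by (simp add: ennreal_mult[symmetric] mult.assoc[symmetric])
      finally show ?thesis by (simp add: add_increasing2)
    qed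
    moreover have "v < \<infinity>" using v by (metis ennreal_less_top infinity_ennreal_def order.strict_trans1)
    ultimately show ?thesis by (subst complementary_le_iff) auto
  qed
  with r(1) show ?thesis by (rule that)
qed

lemma complementary_small:
  assumes "orlicz_function (\<Phi> t)" "0 < e"
  shows "\<exists>n::nat. complementary \<Phi> t (ennreal (1 / Suc n)) \<le> e"
proof -
  obtain r :: real where r: "0 < r"
    "\<And>v. v \<le> ennreal (1 / r) \<Longrightarrow> complementary \<Phi> t v \<le> ennreal r * v"
    by (rule complementary_linear_near_0[where \<Phi> = \<Phi> and t = t]) (use assms in auto)
  obtain d where d: "0 < d" "ennreal d < e"
    using assms(2) by (metis ennreal_rat_dense ennreal_less_zero_iff)
  \<comment> \<open>The first bound puts the point into the range of the linear estimate, the second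
    makes that estimate at most \<open>d\<close>.\<close>
  obtain n where n: "1 / real (Suc n) < min (1 / r) (d / r)"
    using r(1) d(1) by (metis min_less_iff_conj nat_approx_posE zero_less_divide_iff zero_less_one)
  have "complementary \<Phi> t (ennreal (1 / Suc n)) \<le> ennreal r * ennreal (1 / Suc n)"
    using n by (intro r(2) ennreal_leI) simp
  also have "\<dots> = ennreal (r * (1 / Suc n))" using r(1) by (subst ennreal_mult) auto
  also have "\<dots> \<le> ennreal d"
    using n r(1) mult_left_mono[of "1 / Suc n" "d / r" r] by (intro ennreal_leI) auto
  finally show ?thesis using d(2) by (meson less_imp_le order.trans)
qed

lemma b_fun_pos:
  assumes "orlicz_function (\<Phi> t)"
  shows "0 < b_fun (complementary \<Phi>) t"
proof -
  obtain n :: nat where "complementary \<Phi> t (ennreal (1 / Suc n)) \<le> 1"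
    using complementary_small[where \<Phi> = \<Phi> and t = t and e = 1] assms by auto
  then have "ennreal (1 / Suc n) \<le> b_fun (complementary \<Phi>) t"
    by (intro le_b_fun) (use le_less_trans in fastforce)
  then show ?thesis by (meson ennreal_less_zero_iff less_le_trans of_nat_0_less_iff zero_less_Suc zero_less_divide_1_iff)
qed

text \<open>The threshold bounds every chord slope: if \<open>v\<close> is below the slope at
  \<open>r\<close>, arguments beyond \<open>r\<close> contribute nothing to the conjugate at
  \<open>v\<close>, which is then at most \<open>r * v\<close> and hence finite.\<close>

lemma orlicz_function_le_b_fun:
  assumes "orlicz_function (\<Phi> t)" "0 \<le> r"
  shows "\<Phi> t (ennreal r) \<le> b_fun (complementary \<Phi>) t * ennreal r"
proof (cases "r = 0")
  case False
  then have r: "0 < r" using assms by simp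
  have "ennreal (1 / r) * \<Phi> t (ennreal r) \<le> b_fun (complementary \<Phi>) t"
  proof (rule dense_le)
    fix v assume v: "v < ennreal (1 / r) * \<Phi> t (ennreal r)"
    then have vfin: "v < \<infinity>" by (metis infinity_ennreal_def less_le_trans top_greatest)
    have "ennreal x * v \<le> \<Phi> t (ennreal x) + ennreal r * v" if "0 < x" for x
    proof (cases "x \<le> r")
      case True
      then have "ennreal x * v \<le> ennreal r * v" by (intro mult_right_mono ennreal_leI) auto
      then show ?thesis by (simp add: add_increasing)
    next
      case False
      then have "v \<le> ennreal (1 / x) * \<Phi> t (ennreal x)"
        using orlicz_function_quotient_mono[OF assms(1) r, of x 1] v by simp
      then have "ennreal x * v \<le> ennreal x * (ennreal (1 / x) * \<Phi> t (ennreal x))"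
        by (intro mult_left_mono) auto
      also have "\<dots> = \<Phi> t (ennreal x)"
        using \<open>0 < x\<close> by (simp add: ennreal_mult[symmetric] mult.assoc[symmetric])
      finally show ?thesis by (simp add: add_increasing2)
    qed
    then have "complementary \<Phi> t v \<le> ennreal r * v" using vfin by (subst complementary_le_iff) auto
    also have "\<dots> < \<infinity>" using vfin by (simp add: ennreal_mult_less_top)
    finally show "v \<le> b_fun (complementary \<Phi>) t" by (rule le_b_fun)
  qed
  then have "ennreal r * (ennreal (1 / r) * \<Phi> t (ennreal r)) \<le> ennreal r * b_fun (complementary \<Phi>) t"
    by (rule mult_left_mono) simp
  then show ?thesis using r by (simp add: ennreal_mult[symmetric] mult.assoc[symmetric] mult.commute)
qed (simp add: assms)

text \<open>The threshold is the asymptotic slope of \<open>\<Phi> t\<close>. For \<open>v\<close>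
  below it, Young's inequality at \<open>Suc n * w\<close>, divided by \<open>Suc n\<close>, gives
  \<open>v * w\<close> up to an error that tends to 0 because the conjugate is finite at
  \<open>v\<close>.\<close>

lemma b_fun_slope:
  assumes "orlicz_function (\<Phi> t)" "0 \<le> w"
  shows "(SUP n::nat. ennreal (1 / Suc n) * \<Phi> t (ennreal (Suc n) * ennreal w))
    = b_fun (complementary \<Phi>) t * ennreal w" (is "(SUP n. ?s n) = _")
proof (rule antisym)
  show "(SUP n. ?s n) \<le> b_fun (complementary \<Phi>) t * ennreal w"
  proof (rule SUP_least)
    fix n
    have "\<Phi> t (ennreal (Suc n) * ennreal w) \<le> b_fun (complementary \<Phi>) t * ennreal (Suc n * w)"
      using orlicz_function_le_b_fun[of \<Phi> t, OF assms(1), of "Suc n * w"] assms(2)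
      by (simp add: ennreal_mult del: of_nat_Suc)
    then have "?s n \<le> ennreal (1 / Suc n) * (b_fun (complementary \<Phi>) t * ennreal (Suc n * w))"
      by (rule mult_left_mono) simp
    also have "\<dots> = b_fun (complementary \<Phi>) t * (ennreal (1 / Suc n) * ennreal (Suc n * w))"
      by (simp add: ac_simps)
    also have "\<dots> = b_fun (complementary \<Phi>) t * ennreal w"
      using assms(2) by (subst ennreal_mult[symmetric]) (auto simp del: of_nat_Suc)
    finally show "?s n \<le> b_fun (complementary \<Phi>) t * ennreal w" .
  qed
  show "b_fun (complementary \<Phi>) t * ennreal w \<le> (SUP n. ?s n)"
  proof -
    have "v * ennreal w \<le> (SUP n. ?s n)" if v: "v < b_fun (complementary \<Phi>) t" for v
    proof -
      let ?c = "complementary \<Phi> t v"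
      have fin: "?c < \<infinity>"
        by (rule complementary_finite_below_b_fun[where \<Phi> = \<Phi> and t = t, OF v])
      have "v * ennreal w \<le> (SUP n. ?s n) + ennreal (1 / Suc n) * ?c" for n
      proof -
        have "ennreal (Suc n * w) * v \<le> \<Phi> t (ennreal (Suc n * w)) + ?c"
          by (rule young_inequality) simp
        then have "ennreal (1 / Suc n) * (ennreal (Suc n * w) * v)
          \<le> ennreal (1 / Suc n) * (\<Phi> t (ennreal (Suc n * w)) + ?c)"
          by (rule mult_left_mono) simp
        also have "\<dots> = ?s n + ennreal (1 / Suc n) * ?c"
          using assms(2) by (simp add: ennreal_mult distrib_left del: of_nat_Suc)
        also have "\<dots> \<le> (SUP n. ?s n) + ennreal (1 / Suc n) * ?c"
          by (intro add_right_mono SUP_upper) simp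
        also have "ennreal (1 / Suc n) * (ennreal (Suc n * w) * v) = v * ennreal w"
          using assms(2) by (subst mult.assoc[symmetric], subst ennreal_mult[symmetric])
            (auto simp: mult.commute simp del: of_nat_Suc)
        finally show ?thesis .
      qed
      moreover have "(\<lambda>n. (SUP n. ?s n) + ennreal (1 / Suc n) * ?c) \<longlonglongrightarrow> (SUP n. ?s n) + ennreal 0 * ?c"
        using fin by (intro tendsto_add tendsto_mult_ennreal tendsto_const tendsto_ennrealI
            LIMSEQ_Suc lim_1_over_n) auto
      ultimately show ?thesis by (intro LIMSEQ_le_const) auto
    qed
    then have "(SUP v\<in>{..<b_fun (complementary \<Phi>) t}. v * ennreal w) \<le> (SUP n. ?s n)"
      by (intro SUP_least) auto
    moreover have "b_fun (complementary \<Phi>) t = (SUP v\<in>{..<b_fun (complementary \<Phi>) t}. v)"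
      by (simp only: image_ident Sup_lessThan)
    ultimately show ?thesis
      by (metis (no_types, lifting) SUP_cong SUP_mult_right_ennreal)
  qed
qed

text \<open>The gap between the line of slope \<open>b\<close> and the function is concave and
  nonnegative on a half-line, and such a function cannot decrease.\<close>

lemma b_fun_minus_mono: 
  assumes "orlicz_function (\<Phi> t)" and b: "b_fun (complementary \<Phi>) t = ennreal b" "0 \<le> b"
    and "0 \<le> w" "w \<le> w'"
  shows "b * w - enn2real (\<Phi> t (ennreal w)) \<le> b * w' - enn2real (\<Phi> t (ennreal w'))"
proof (cases "w = w'")
  case False
  then have lt: "w < w'" using assms by simp
  define g where "g = (\<lambda>w. b * w - enn2real (\<Phi> t (ennreal w)))"
  have le: "\<Phi> t (ennreal r) \<le> ennreal (b * r)" if "0 \<le> r" for r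
    using orlicz_function_le_b_fun[of \<Phi> t, OF assms(1) that] b that by (simp add: ennreal_mult)
  have gn: "0 \<le> g r" if "0 \<le> r" for r
    unfolding g_def using enn2real_mono[OF le[OF that]] b that by simp
  have conv: "\<Phi> t (ennreal k * x + ennreal (1 - k) * y) \<le> ennreal k * \<Phi> t x + ennreal (1 - k) * \<Phi> t y"
    if "0 \<le> k" "k \<le> 1" for k x y
    using assms(1) that unfolding orlicz_function_def ennreal_convex_def by simp
  have "(1 - (w' - w) / (real n + 1)) * g w \<le> g w'" if n: "n \<ge> nat \<lceil>w' - w\<rceil>" for n :: nat
  proof -
    \<comment> \<open>\<open>w'\<close> is the convex combination of \<open>w\<close> and the
      distant point \<open>W\<close> with weight \<open>l\<close> on \<open>W\<close>. The
      nonnegative term at \<open>W\<close> is dropped, and \<open>l\<close> tends to 0 as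
      \<open>n\<close> grows.\<close>
    define l where "l = (w' - w) / (real n + 1)"
    define W where "W = w + (real n + 1)"
    have "w' - w \<le> real n + 1" using n by linarith
    then have l: "0 \<le> l" "l \<le> 1" using lt unfolding l_def by auto
    have "l * (real n + 1) = w' - w" unfolding l_def by simp
    then have w': "w' = (1 - l) * w + l * W" unfolding W_def by (simp add: algebra_simps)
    have W: "0 \<le> W" using assms unfolding W_def by simp
    have fin: "\<Phi> t (ennreal r) = ennreal (enn2real (\<Phi> t (ennreal r)))" if "0 \<le> r" for r
      using le[OF that] by (metis ennreal_enn2real ennreal_less_top order.strict_trans1)
    have "\<Phi> t (ennreal (1 - l) * ennreal w + ennreal (1 - (1 - l)) * ennreal W)
      \<le> ennreal (1 - l) * \<Phi> t (ennreal w) + ennreal (1 - (1 - l)) * \<Phi> t (ennreal W)"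
      using conv[of "1 - l"] l by simp
    moreover have "ennreal (1 - l) * ennreal w + ennreal (1 - (1 - l)) * ennreal W = ennreal w'"
      using l assms W unfolding w' by (simp add: ennreal_mult)
    ultimately have "\<Phi> t (ennreal w') \<le> ennreal ((1 - l) * enn2real (\<Phi> t (ennreal w)) + l * enn2real (\<Phi> t (ennreal W)))"
      using l assms(4) W fin[of w] fin[of W] by (simp add: ennreal_mult)
    then have "enn2real (\<Phi> t (ennreal w')) \<le> (1 - l) * enn2real (\<Phi> t (ennreal w)) + l * enn2real (\<Phi> t (ennreal W))"
      using l by (intro enn2real_leI) auto
    then have "(1 - l) * g w + l * g W \<le> g w'"
      unfolding g_def w' by (simp add: algebra_simps)
    moreover have "0 \<le> l * g W" using gn[OF W] l by simp
    ultimately show ?thesis unfolding l_def by linarith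
  qed
  moreover have "(\<lambda>n::nat. (1 - (w' - w) / (real n + 1)) * g w) \<longlonglongrightarrow> (1 - 0) * g w"
  proof (intro tendsto_intros)
    have "(\<lambda>n::nat. (w' - w) * (1 / real (Suc n))) \<longlonglongrightarrow> (w' - w) * 0"
      by (intro tendsto_intros LIMSEQ_Suc lim_1_over_n)
    then show "(\<lambda>n::nat. (w' - w) / (real n + 1)) \<longlonglongrightarrow> 0" by (simp add: add.commute)
  qed
  ultimately have "g w \<le> g w'"
    by (intro LIMSEQ_le_const2[of "\<lambda>n. (1 - (w' - w) / (real n + 1)) * g w"] exI[of _ "nat \<lceil>w' - w\<rceil>"]) auto
  then show ?thesis unfolding g_def .
qed simp

text \<open>The terms of the supremum defining the conjugate at \<open>b\<close> increase by
  \<open>b_fun_minus_mono\<close>, so any arguments tending to infinity exhaust it. The limit may be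
  infinite.\<close>

lemma complementary_b_fun_tendsto:
  assumes "orlicz_function (\<Phi> t)" and b: "b_fun (complementary \<Phi>) t = ennreal b" "0 \<le> b"
    and Y: "filterlim Y at_top F"
  shows "((\<lambda>n. ennreal (b * Y n - enn2real (\<Phi> t (ennreal (Y n)))))
    \<longlongrightarrow> complementary \<Phi> t (ennreal b)) F"
proof -
  define g where "g = (\<lambda>w. b * w - enn2real (\<Phi> t (ennreal w)))"
  have g: "ennreal w * ennreal b - \<Phi> t (ennreal w) = ennreal (g w)" if "0 \<le> w" for w
  proof -
    have "\<Phi> t (ennreal w) = ennreal (enn2real (\<Phi> t (ennreal w)))"
      using orlicz_function_le_b_fun[of \<Phi> t, OF assms(1) that] b that
      by (metis ennreal_enn2real ennreal_less_top ennreal_mult order.strict_trans1)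
    then show ?thesis
      using that b(2) unfolding g_def
      by (metis ennreal_minus ennreal_mult enn2real_nonneg mult.commute)
  qed
  show ?thesis
    unfolding g_def[symmetric]
  proof (rule order_tendstoI)
    fix a assume a: "complementary \<Phi> t (ennreal b) < a"
    have up: "ennreal (g w) \<le> complementary \<Phi> t (ennreal b)" if "0 < w" for w
      using that g[of w] unfolding complementary_def
      by (intro SUP_upper2[of "ennreal w"]) (auto simp: ennreal_less_zero_iff)
    have "eventually (\<lambda>n. 1 \<le> Y n) F" using Y by (simp add: filterlim_at_top)
    then show "eventually (\<lambda>n. ennreal (b * Y n - enn2real (\<Phi> t (ennreal (Y n)))) < a) F"
      by eventually_elim (use a order.strict_trans1[OF up] in \<open>simp add: g_def\<close>)
  next
    fix a assume a: "a < complementary \<Phi> t (ennreal b)"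
    then obtain x where x: "x \<in> {0<..<\<infinity>}" "a < x * ennreal b - \<Phi> t x"
      unfolding complementary_def less_SUP_iff by blast
    then obtain r where r: "x = ennreal r" "0 \<le> r" by (cases x) auto
    have "eventually (\<lambda>n. r \<le> Y n) F" using Y by (simp add: filterlim_at_top)
    then show "eventually (\<lambda>n. a < ennreal (b * Y n - enn2real (\<Phi> t (ennreal (Y n))))) F"
    proof eventually_elim
      case (elim n)
      have "g r \<le> g (Y n)" unfolding g_def
        using b_fun_minus_mono[where t = t and \<Phi> = \<Phi>, OF assms(1) b] r elim by simp
      then have "ennreal (g r) \<le> ennreal (g (Y n))" by (rule ennreal_leI)
      then show ?case using x(2) g[OF r(2)] r(1) unfolding g_def by simp
    qed
  qed
qed

lemma b_fun_minus_nonneg: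
  assumes "orlicz_function (\<Phi> t)" and b: "b_fun (complementary \<Phi>) t = ennreal b" "0 \<le> b" "0 \<le> w"
  shows "0 \<le> b * w - enn2real (\<Phi> t (ennreal w))"
  using enn2real_mono[OF orlicz_function_le_b_fun[of \<Phi> t, OF assms(1) assms(4)]] b
  by (simp add: ennreal_mult_less_top enn2real_mult)

text \<open>With a finite limit the convergence holds between reals, the form that dominated
  convergence for Bochner integrals takes.\<close>

lemma complementary_b_fun_tendsto_real:
  assumes "orlicz_function (\<Phi> t)" and b: "b_fun (complementary \<Phi>) t = ennreal b" "0 \<le> b"
    and fin: "complementary \<Phi> t (ennreal b) < \<infinity>"
    and Y: "filterlim Y at_top F"
  shows "((\<lambda>n. b * Y n - enn2real (\<Phi> t (ennreal (Y n))))
    \<longlongrightarrow> enn2real (complementary \<Phi> t (ennreal b))) F"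
proof -
  have "((\<lambda>n. enn2real (ennreal (b * Y n - enn2real (\<Phi> t (ennreal (Y n))))))
      \<longlongrightarrow> enn2real (complementary \<Phi> t (ennreal b))) F"
    using complementary_b_fun_tendsto[of \<Phi> t b Y F] assms by (intro tendsto_enn2real) auto
  moreover have "eventually (\<lambda>n. 0 \<le> Y n) F" using Y by (simp add: filterlim_at_top)
  then have "eventually (\<lambda>n. enn2real (ennreal (b * Y n - enn2real (\<Phi> t (ennreal (Y n)))))
      = b * Y n - enn2real (\<Phi> t (ennreal (Y n)))) F"
    by eventually_elim (use b_fun_minus_nonneg[of \<Phi> t b] assms in auto)
  ultimately show ?thesis by (simp cong: tendsto_cong add: tendsto_cong)
qed

text \<open>The conjugate is finite on an initial segment, so rational points determine the
  threshold; this gives its measurability.\<close>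

lemma b_fun_eq_SUP:
  "b_fun (complementary \<Phi>) t
    = (SUP q::rat. if complementary \<Phi> t (ennreal (of_rat q)) < \<infinity> then ennreal (of_rat q) else 0)"
proof (rule antisym)
  show "b_fun (complementary \<Phi>) t
    \<le> (SUP q::rat. if complementary \<Phi> t (ennreal (of_rat q)) < \<infinity> then ennreal (of_rat q) else 0)"
  proof (rule dense_le)
    fix y assume "y < b_fun (complementary \<Phi>) t"
    then obtain q :: rat where "y < ennreal (of_rat q)" "ennreal (of_rat q) < b_fun (complementary \<Phi>) t"
      using ennreal_rat_dense by metis
    then show "y \<le> (SUP q::rat. if complementary \<Phi> t (ennreal (of_rat q)) < \<infinity> then ennreal (of_rat q) else 0)"
      using complementary_finite_below_b_fun[of "ennreal (of_rat q)" \<Phi> t]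
      by (intro SUP_upper2[of q]) auto
  qed
qed (rule SUP_least, auto intro: le_b_fun)

lemma a_fun_eq_SUP:
  "a_fun (complementary \<Phi>) t
    = (SUP q::rat. if complementary \<Phi> t (ennreal (of_rat q)) = 0 then ennreal (of_rat q) else 0)"
proof (rule antisym)
  show "a_fun (complementary \<Phi>) t
    \<le> (SUP q::rat. if complementary \<Phi> t (ennreal (of_rat q)) = 0 then ennreal (of_rat q) else 0)"
  proof (rule dense_le)
    fix y assume "y < a_fun (complementary \<Phi>) t"
    then obtain q :: rat where "y < ennreal (of_rat q)" "ennreal (of_rat q) < a_fun (complementary \<Phi>) t"
      using ennreal_rat_dense by metis
    then show "y \<le> (SUP q::rat. if complementary \<Phi> t (ennreal (of_rat q)) = 0 then ennreal (of_rat q) else 0)"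
      using complementary_zero_below_a_fun[of "ennreal (of_rat q)" \<Phi> t]
      by (intro SUP_upper2[of q]) auto
  qed
qed (rule SUP_least, auto intro: le_a_fun)

text \<open>If the chord slopes towards 0 kept these terms above some \<open>e > 0\<close>, then
  \<open>\<Phi> t r \<ge> r * e / w\<close> for all \<open>r > 0\<close>, and the conjugate would
  vanish at \<open>e / w\<close>.\<close>

lemma a_fun_zero_slope:
  assumes "orlicz_function (\<Phi> t)" "a_fun (complementary \<Phi>) t = 0" "\<Phi> t (ennreal w) < \<infinity>" "0 \<le> w"
  shows "(INF n::nat. ennreal (Suc n) * \<Phi> t (ennreal (1 / Suc n) * ennreal w)) = 0"
proof (rule ccontr)
  assume "\<not> ?thesis"
  then have "0 < (INF n::nat. ennreal (Suc n) * \<Phi> t (ennreal (1 / Suc n) * ennreal w))"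
    by (simp only: zero_less_iff_neq_zero not_False_eq_True)
  from ennreal_rat_dense[OF this] obtain e where e: "0 < e"
    "ennreal e < (INF n::nat. ennreal (Suc n) * \<Phi> t (ennreal (1 / Suc n) * ennreal w))"
    by (metis ennreal_less_zero_iff)
  have w: "0 < w"
  proof (rule ccontr)
    assume "\<not> 0 < w"
    then have "w = 0" using assms by simp
    then show False using e assms(1) by simp
  qed
  have "complementary \<Phi> t (ennreal (e / w)) \<le> 0"
  proof (subst complementary_le_iff)
    show "\<forall>r>0. ennreal r * ennreal (e / w) \<le> \<Phi> t (ennreal r) + 0"
    proof (intro allI impI)
      fix r :: real assume r: "0 < r"
      \<comment> \<open>With \<open>1 / Suc n\<close> below \<open>r / w\<close>, monotone chord
        slopes carry the bound from the sequence to the arbitrary argument \<open>r\<close>.\<close>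
      obtain n :: nat where n: "1 / real (Suc n) < r / w" using r w nat_approx_posE by (metis divide_pos_pos)
      have "ennreal e \<le> ennreal (Suc n) * \<Phi> t (ennreal (1 / Suc n) * ennreal w)"
        using e(2) by (meson INF_lower UNIV_I less_imp_le order.trans)
      also have "\<dots> \<le> ennreal (w / r) * \<Phi> t (ennreal (r / w) * ennreal w)"
        using orlicz_function_quotient_mono[OF assms(1), of "1 / Suc n" "r / w" "ennreal w"] n by simp
      also have "\<dots> = ennreal (w / r) * \<Phi> t (ennreal r)"
        using r w by (simp add: ennreal_mult[symmetric])
      finally have "ennreal (r / w) * ennreal e \<le> ennreal (r / w) * (ennreal (w / r) * \<Phi> t (ennreal r))"
        by (rule mult_left_mono) simp
      then show "ennreal r * ennreal (e / w) \<le> \<Phi> t (ennreal r) + 0"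
        using r w e(1) by (simp add: ennreal_mult[symmetric] mult.assoc[symmetric])
    qed
  qed simp
  then have "ennreal (e / w) \<le> 0"
    using le_a_fun[where \<Phi>=\<Phi> and t = t, of "ennreal (e / w)"] assms(2) by simp
  moreover have "0 < e / w" using e(1) w by simp
  ultimately show False by (metis ennreal_less_zero_iff not_le)
qed

subsection \<open>Modulars, the Orlicz norm and its functionals\<close>

text \<open>The Orlicz conditions are imposed at every \<open>t\<close>, so pointwise lemmas apply
  without exceptional sets; the concluding theorem arranges this by modifying \<open>\<Phi>\<close>
  on a null set.\<close>

locale musielak_orlicz_space = sigma_finite_measure M for M :: "'a measure" +
  fixes \<Phi> :: "'a \<Rightarrow> ennreal \<Rightarrow> ennreal"
  assumes measurable_Phi: "(\<lambda>t. \<Phi> t c) \<in> borel_measurable M"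
    and orlicz: "orlicz_function (\<Phi> t)"
begin

abbreviation "\<Psi> \<equiv> complementary \<Phi>"
abbreviation "b \<equiv> b_fun (complementary \<Phi>)"
abbreviation "L \<equiv> L_space M \<Phi>"
abbreviation "I \<equiv> modular_real M \<Phi>"
abbreviation "I' \<equiv> modular_real M \<Psi>"

lemma measurable_Phi_comp [measurable]:
  assumes [measurable]: "w \<in> borel_measurable M"
  shows "(\<lambda>t. \<Phi> t (w t)) \<in> borel_measurable M"
proof -
  note measurable_Phi [measurable]
  show ?thesis
    by (subst orlicz_function_eq_SUP[OF orlicz]) (intro borel_measurable_SUP; measurable)
qed

lemma measurable_Psi [measurable]:
  assumes [measurable]: "w \<in> borel_measurable M"
  shows "(\<lambda>t. \<Psi> t (w t)) \<in> borel_measurable M"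
  by (subst complementary_eq_SUP[OF orlicz]) (intro borel_measurable_SUP; measurable)

lemma measurable_b [measurable]: "b \<in> borel_measurable M"
proof -
  have "(\<lambda>t. b t) \<in> borel_measurable M"
    by (subst b_fun_eq_SUP) (intro borel_measurable_SUP; measurable)
  then show ?thesis by simp
qed

lemma measurable_a [measurable]: "a_fun \<Psi> \<in> borel_measurable M"
proof -
  have "(\<lambda>t. a_fun \<Psi> t) \<in> borel_measurable M"
    by (subst a_fun_eq_SUP) (intro borel_measurable_SUP; measurable)
  then show ?thesis by simp
qed

section \<open>Modulars and integrability of products\<close>

lemma modular_real_eq: "modular_real M F x = (\<integral>\<^sup>+t. F t (ennreal \<bar>x t\<bar>) \<partial>M)"
  unfolding modular_real_def modular_def ..

lemma L_measurable: "x \<in> L \<Longrightarrow> x \<in> borel_measurable M"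
  unfolding L_space_def by simp

lemma in_L_if_modular_finite: "x \<in> borel_measurable M \<Longrightarrow> I x < \<infinity> \<Longrightarrow> x \<in> L"
  unfolding L_space_def by (auto intro!: exI[of _ 1])

lemma young_nn_integral:
  assumes [measurable]: "x \<in> borel_measurable M" "v \<in> borel_measurable M"
  shows "(\<integral>\<^sup>+t. ennreal \<bar>x t * v t\<bar> \<partial>M) \<le> I x + I' v"
proof -
  have "(\<integral>\<^sup>+t. ennreal \<bar>x t * v t\<bar> \<partial>M) \<le> (\<integral>\<^sup>+t. \<Phi> t (ennreal \<bar>x t\<bar>) + \<Psi> t (ennreal \<bar>v t\<bar>) \<partial>M)"
    using young_inequality[of "ennreal \<bar>x _\<bar>" "ennreal \<bar>v _\<bar>" \<Phi>]
    by (intro nn_integral_mono) (simp add: abs_mult ennreal_mult)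
  also have "\<dots> = I x + I' v"
    unfolding modular_real_eq by (intro nn_integral_add) measurable
  finally show ?thesis .
qed

lemma young_integral:
  assumes [measurable]: "x \<in> borel_measurable M" "v \<in> borel_measurable M"
    and fin: "I x < \<infinity>" "I' v < \<infinity>"
  shows "integrable M (\<lambda>t. x t * v t)"
    and "\<bar>LINT t|M. x t * v t\<bar> \<le> enn2real (I x) + enn2real (I' v)"
proof -
  have *: "(\<integral>\<^sup>+t. ennreal (norm (x t * v t)) \<partial>M) \<le> I x + I' v"
    using young_nn_integral[OF assms(1,2)] by simp
  then show "integrable M (\<lambda>t. x t * v t)"
    using fin by (intro integrableI_bounded) (auto simp: le_less_trans)
  have "ennreal \<bar>LINT t|M. x t * v t\<bar> \<le> I x + I' v"
    using integral_norm_bound_ennreal[OF \<open>integrable M _\<close>] * by simp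
  then have "\<bar>LINT t|M. x t * v t\<bar> \<le> enn2real (I x + I' v)"
    using enn2real_mono[of "ennreal \<bar>LINT t|M. x t * v t\<bar>" "I x + I' v"] fin by simp
  then show "\<bar>LINT t|M. x t * v t\<bar> \<le> enn2real (I x) + enn2real (I' v)"
    using fin by (simp add: enn2real_plus)
qed

lemma integrable_L_mult:
  assumes "x \<in> L" "v \<in> borel_measurable M" "I' v < \<infinity>"
  shows "integrable M (\<lambda>t. x t * v t)"
proof -
  obtain c where c: "0 < c" "I (\<lambda>t. c * x t) < \<infinity>" using assms(1) unfolding L_space_def by auto
  have "integrable M (\<lambda>t. (c * x t) * v t)"
    using assms c L_measurable by (intro young_integral) auto
  then show ?thesis using c(1) by (simp add: mult.assoc)
qed

section \<open>The Orlicz norm and the vector space \<open>L\<close>\<close>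

abbreviation "unit_mod \<equiv> {v \<in> L_class M \<Psi>. I' v \<le> 1}"

lemma unit_modI: "v \<in> borel_measurable M \<Longrightarrow> I' v \<le> 1 \<Longrightarrow> v \<in> unit_mod"
  unfolding L_class_def by (auto simp: le_less_trans)

lemma unit_modD: "v \<in> unit_mod \<Longrightarrow> v \<in> borel_measurable M \<and> I' v \<le> 1 \<and> I' v < \<infinity>"
  unfolding L_class_def by auto

lemma zero_in_unit_mod: "(\<lambda>t. 0) \<in> unit_mod"
  by (rule unit_modI) (auto simp: modular_real_eq)

text \<open>Boundedness gives the real supremum in \<open>orlicz_norm\<close> its meaning. Young's
  inequality for \<open>c * x\<close> yields a bound independent of \<open>v\<close>.\<close>

lemma bdd_above_orlicz:
  assumes "x \<in> L"
  shows "bdd_above ((\<lambda>v. \<bar>LINT t|M. x t * v t\<bar>) ` unit_mod)"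
proof -
  obtain c where c: "0 < c" "I (\<lambda>t. c * x t) < \<infinity>" using assms(1) unfolding L_space_def by auto
  show ?thesis
  proof (rule bdd_aboveI2)
    fix v assume v: "v \<in> unit_mod"
    have "\<bar>LINT t|M. (c * x t) * v t\<bar> \<le> enn2real (I (\<lambda>t. c * x t)) + enn2real (I' v)"
      using unit_modD[OF v] c L_measurable[OF assms] by (intro young_integral) auto
    also have "enn2real (I' v) \<le> 1" using unit_modD[OF v] by (simp add: enn2real_leI)
    finally have "c * \<bar>LINT t|M. x t * v t\<bar> \<le> enn2real (I (\<lambda>t. c * x t)) + 1"
      using c(1) by (simp add: mult.assoc abs_mult)
    then show "\<bar>LINT t|M. x t * v t\<bar> \<le> (enn2real (I (\<lambda>t. c * x t)) + 1) / c"
      using c(1) by (simp add: field_simps)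
  qed
qed

lemma orlicz_norm_upper:
  "x \<in> L \<Longrightarrow> v \<in> borel_measurable M \<Longrightarrow> I' v \<le> 1 \<Longrightarrow> \<bar>LINT t|M. x t * v t\<bar> \<le> orlicz_norm M \<Phi> x"
  unfolding orlicz_norm_def by (intro cSUP_upper unit_modI bdd_above_orlicz)

lemma orlicz_norm_least:
  assumes "\<And>v. v \<in> borel_measurable M \<Longrightarrow> I' v \<le> 1 \<Longrightarrow> \<bar>LINT t|M. x t * v t\<bar> \<le> B"
  shows "orlicz_norm M \<Phi> x \<le> B"
  unfolding orlicz_norm_def
proof (rule cSUP_least)
  show "unit_mod \<noteq> {}" using zero_in_unit_mod by blast
  show "\<bar>LINT t|M. x t * v t\<bar> \<le> B" if "v \<in> unit_mod" for v
    using unit_modD[OF that] assms[of v] by blast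
qed

lemma orlicz_norm_nonneg: "x \<in> L \<Longrightarrow> 0 \<le> orlicz_norm M \<Phi> x"
  using orlicz_norm_upper[of x "\<lambda>t. 0"] unit_modD[OF zero_in_unit_mod] by simp

text \<open>The Amemiya bound at \<open>k = 1\<close>, which is Young's inequality with
  \<open>I' v \<le> 1\<close>.\<close>

lemma orlicz_norm_le_modular:
  assumes "x \<in> borel_measurable M" "I x < \<infinity>"
  shows "orlicz_norm M \<Phi> x \<le> 1 + enn2real (I x)"
proof (rule orlicz_norm_least)
  fix v assume v: "v \<in> borel_measurable M" "I' v \<le> 1"
  have "\<bar>LINT t|M. x t * v t\<bar> \<le> enn2real (I x) + enn2real (I' v)"
    using assms v by (intro young_integral) (auto simp: le_less_trans)
  also have "enn2real (I' v) \<le> 1" using v by (simp add: enn2real_leI)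
  finally show "\<bar>LINT t|M. x t * v t\<bar> \<le> 1 + enn2real (I x)" by simp
qed

lemma orlicz_norm_scale_le:
  assumes "x \<in> L"
  shows "orlicz_norm M \<Phi> (\<lambda>t. c * x t) \<le> \<bar>c\<bar> * orlicz_norm M \<Phi> x"
proof (rule orlicz_norm_least)
  fix v assume v: "v \<in> borel_measurable M" "I' v \<le> 1"
  show "\<bar>LINT t|M. c * x t * v t\<bar> \<le> \<bar>c\<bar> * orlicz_norm M \<Phi> x"
    using orlicz_norm_upper[OF assms v] by (simp add: mult.assoc abs_mult mult_left_mono)
qed

lemma modular_real_mono:
  assumes "\<And>t. \<bar>x t\<bar> \<le> \<bar>y t\<bar>"
  shows "I x \<le> I y"
  unfolding modular_real_eq
  by (intro nn_integral_mono orlicz_function_mono[OF orlicz] ennreal_leI assms)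

lemma L_scale:
  assumes "x \<in> L"
  shows "(\<lambda>t. c * x t) \<in> L"
proof (cases "c = 0")
  case True
  then show ?thesis by (intro in_L_if_modular_finite) (auto simp: modular_real_eq orlicz)
next
  case False
  obtain d where d: "0 < d" "I (\<lambda>t. d * x t) < \<infinity>" using assms(1) unfolding L_space_def by auto
  have "I (\<lambda>t. d / \<bar>c\<bar> * (c * x t)) = I (\<lambda>t. d * x t)"
    unfolding modular_real_eq using False d(1) by (simp add: abs_mult)
  then show ?thesis using L_measurable[OF assms] d False unfolding L_space_def
    by (auto intro!: exI[of _ "d / \<bar>c\<bar>"])
qed

lemma L_add:
  assumes "x \<in> L" "y \<in> L"
  shows "(\<lambda>t. x t + y t) \<in> L"
proof -
  obtain c where c: "0 < c" "I (\<lambda>t. c * x t) < \<infinity>" using assms(1) unfolding L_space_def by auto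
  obtain d where d: "0 < d" "I (\<lambda>t. d * y t) < \<infinity>" using assms(2) unfolding L_space_def by auto
  note [measurable] = L_measurable[OF assms(1)] L_measurable[OF assms(2)]
  \<comment> \<open>With this factor \<open>e * (x + y)\<close> is bounded by the average of
    \<open>c * x\<close> and \<open>d * y\<close> in absolute value, hence by the larger of the two,
    and monotonicity finishes.\<close>
  define e where "e = min c d / 2"
  have "I (\<lambda>t. e * (x t + y t)) \<le> (\<integral>\<^sup>+t. \<Phi> t (ennreal \<bar>c * x t\<bar>) + \<Phi> t (ennreal \<bar>d * y t\<bar>) \<partial>M)"
    unfolding modular_real_eq
  proof (rule nn_integral_mono)
    fix t
    have "\<bar>e * (x t + y t)\<bar> \<le> e * \<bar>x t\<bar> + e * \<bar>y t\<bar>"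
      using c(1) d(1) unfolding e_def by (simp add: abs_mult distrib_left[symmetric] abs_triangle_ineq)
    also have "e * \<bar>x t\<bar> \<le> \<bar>c * x t\<bar> / 2"
      using c(1) d(1) mult_right_mono[of "min c d" c "\<bar>x t\<bar>"] unfolding e_def by (simp add: abs_mult)
    also have "e * \<bar>y t\<bar> \<le> \<bar>d * y t\<bar> / 2"
      using c(1) d(1) mult_right_mono[of "min c d" d "\<bar>y t\<bar>"] unfolding e_def by (simp add: abs_mult)
    finally have "\<bar>e * (x t + y t)\<bar> \<le> \<bar>c * x t\<bar> \<or> \<bar>e * (x t + y t)\<bar> \<le> \<bar>d * y t\<bar>" by linarith
    then show "\<Phi> t (ennreal \<bar>e * (x t + y t)\<bar>) \<le> \<Phi> t (ennreal \<bar>c * x t\<bar>) + \<Phi> t (ennreal \<bar>d * y t\<bar>)"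
      by (metis add_increasing add_increasing2 ennreal_leI orlicz orlicz_function_mono zero_le)
  qed
  also have "\<dots> = I (\<lambda>t. c * x t) + I (\<lambda>t. d * y t)"
    unfolding modular_real_eq by (intro nn_integral_add) measurable
  also have "\<dots> < \<infinity>" using c d by simp
  finally show ?thesis
    using c(1) d(1) unfolding L_space_def e_def by (auto intro!: exI[of _ "min c d / 2"])
qed

section \<open>Functionals given by integration, and the modular bound on support
  functionals\<close>

definition functional :: "('a \<Rightarrow> real) \<Rightarrow> ('a \<Rightarrow> real) \<Rightarrow> real" where
  "functional v = restrict (\<lambda>x. LINT t|M. x t * v t) L"

text \<open>The dual norm is at most 1 by the definition of the Orlicz norm, and the normalised
  \<open>u\<close> attains 1.\<close>

lemma functional_support:
  assumes v: "v \<in> borel_measurable M" "I' v \<le> 1"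
    and u: "u \<in> L" "0 < orlicz_norm M \<Phi> u" "(LINT t|M. u t * v t) = orlicz_norm M \<Phi> u"
  shows "support_functional M \<Phi> u (functional v)"
proof -
  have v': "I' v < \<infinity>" using v by (simp add: le_less_trans)
  have le: "\<bar>functional v x\<bar> \<le> orlicz_norm M \<Phi> x" if "x \<in> L" for x
    unfolding functional_def using orlicz_norm_upper[OF that v] that by simp
  have "functional v \<in> dual_space M \<Phi>"
    unfolding dual_space_def
  proof (intro CollectI conjI ballI allI)
    show "functional v \<in> extensional L" unfolding functional_def by simp
    show "functional v (\<lambda>t. x t + y t) = functional v x + functional v y" if "x \<in> L" "y \<in> L" for x y
      unfolding functional_def using that L_add[OF that]
      by (simp add: distrib_right integrable_L_mult[OF _ v(1) v'])
    show "functional v (\<lambda>t. c * x t) = c * functional v x" if "x \<in> L" for c x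
      unfolding functional_def using that L_scale[OF that] by (simp add: mult.assoc)
    show "\<exists>C. \<forall>x\<in>L. \<bar>functional v x\<bar> \<le> C * orlicz_norm M \<Phi> x"
      using le by (intro exI[of _ 1]) auto
  qed
  moreover have "dual_norm M \<Phi> (functional v) = 1"
  proof (rule antisym)
    have zero: "(\<lambda>t. 0 * u t) \<in> L" "orlicz_norm M \<Phi> (\<lambda>t. 0 * u t) \<le> 1"
      using L_scale[OF u(1), of 0] orlicz_norm_scale_le[OF u(1), of 0] by auto
    show "dual_norm M \<Phi> (functional v) \<le> 1"
      unfolding dual_norm_def
      by (rule cSUP_least) (use zero order.trans[OF le] in blast)+
    define y where "y = (\<lambda>t. 1 / orlicz_norm M \<Phi> u * u t)"
    have y: "y \<in> L" "orlicz_norm M \<Phi> y \<le> 1"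
      unfolding y_def using orlicz_norm_scale_le[OF u(1), of "1 / orlicz_norm M \<Phi> u"] u(2)
      by (intro L_scale[OF u(1)], simp)
    have "\<bar>functional v y\<bar> \<le> dual_norm M \<Phi> (functional v)"
      unfolding dual_norm_def
      by (rule cSUP_upper) (use y order.trans[OF le] in \<open>auto intro!: bdd_aboveI2[where M=1]\<close>)
    moreover have "functional v y = 1"
      using y(1) u(2,3) unfolding functional_def y_def by (simp add: mult.assoc)
    ultimately show "1 \<le> dual_norm M \<Phi> (functional v)" by simp
  qed
  moreover have "functional v u = orlicz_norm M \<Phi> u"
    using u unfolding functional_def by simp
  ultimately show ?thesis unfolding support_functional_def by simp
qed

text \<open>Dual norm 1 gives \<open>f x \<le> orlicz_norm M \<Phi> x\<close>, and the Amemiya bound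
  does the rest. This covers every support functional, whether or not it is given by
  integration.\<close>

lemma support_functional_le_modular:
  assumes f: "support_functional M \<Phi> u f" and x: "x \<in> borel_measurable M" "I x < \<infinity>"
  shows "f x \<le> 1 + enn2real (I x)"
proof -
  have xL: "x \<in> L" using x by (rule in_L_if_modular_finite)
  have scale: "f (\<lambda>t. c * x t) = c * f x" for c
    using f xL unfolding support_functional_def dual_space_def by blast
  obtain C where C: "\<And>y. y \<in> L \<Longrightarrow> \<bar>f y\<bar> \<le> C * orlicz_norm M \<Phi> y"
    using f unfolding support_functional_def dual_space_def by blast
  have "f x \<le> orlicz_norm M \<Phi> x"
  \<comment> \<open>An element of norm 0 cannot be normalised; there the boundedness constant forces
    \<open>f x = 0\<close>.\<close>
  proof (cases "orlicz_norm M \<Phi> x = 0")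
    case True
    then show ?thesis using C[OF xL] by simp
  next
    case False
    then have pos: "0 < orlicz_norm M \<Phi> x" using orlicz_norm_nonneg[OF xL] by simp
    define y where "y = (\<lambda>t. 1 / orlicz_norm M \<Phi> x * x t)"
    have y: "y \<in> L" "orlicz_norm M \<Phi> y \<le> 1"
      unfolding y_def using orlicz_norm_scale_le[OF xL, of "1 / orlicz_norm M \<Phi> x"] pos
      by (intro L_scale[OF xL], simp)
    \<comment> \<open>The real supremum \<open>dual_norm\<close> dominates its members only once
      they are bounded; the absolute value covers a negative \<open>C\<close>.\<close>
    have "bdd_above ((\<lambda>x. \<bar>f x\<bar>) ` {x \<in> L. orlicz_norm M \<Phi> x \<le> 1})"
    proof (rule bdd_aboveI2)
      fix z assume z: "z \<in> {x \<in> L. orlicz_norm M \<Phi> x \<le> 1}"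
      then have "\<bar>f z\<bar> \<le> C * orlicz_norm M \<Phi> z" using C by simp
      also have "\<dots> \<le> \<bar>C\<bar> * 1"
        using z orlicz_norm_nonneg[of z] by (intro mult_mono) auto
      finally show "\<bar>f z\<bar> \<le> \<bar>C\<bar>" by simp
    qed
    then have "\<bar>f y\<bar> \<le> dual_norm M \<Phi> f"
      unfolding dual_norm_def using y by (intro cSUP_upper) auto
    also have "\<dots> = 1" using f unfolding support_functional_def by simp
    finally have "f y \<le> 1" by simp
    then show ?thesis using pos unfolding y_def scale by (simp add: field_simps)
  qed
  also have "\<dots> \<le> 1 + enn2real (I x)" by (rule orlicz_norm_le_modular[OF x])
  finally show ?thesis .
qed

text \<open>Sigma-finiteness supplies a positive integrable weight, and at each point a small enough
  positive value keeps \<open>F\<close> below a multiple of it. This is applied both to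
  \<open>\<Phi>\<close> and to its conjugate.\<close>

lemma exists_pos_small_modular:
  assumes F: "\<And>n::nat. (\<lambda>t. F t (ennreal (1 / Suc n))) \<in> borel_measurable M"
    and small: "\<And>t e. 0 < e \<Longrightarrow> \<exists>n::nat. F t (ennreal (1 / Suc n)) \<le> e"
    and e: "0 < e"
  obtains x where "x \<in> borel_measurable M" "\<And>t. 0 < x t" "modular_real M F x \<le> e"
proof -
  note F [measurable]
  obtain h where h [measurable]: "h \<in> borel_measurable M" and hfin: "integral\<^sup>N M h \<noteq> \<infinity>"
    and hpos: "\<And>t. t \<in> space M \<Longrightarrow> 0 < h t \<and> h t < \<infinity>"
    using Ex_finite_integrable_function by blast
  obtain d :: real where d: "0 < d" "ennreal d < e" 
    using ennreal_rat_dense[OF e] by (metis ennreal_less_zero_iff)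
  \<comment> \<open>The \<open>+ 1\<close> keeps the denominator positive, while \<open>s\<close>
    times the integral of \<open>h\<close> stays at most \<open>d\<close>.\<close>
  define s where "s = ennreal (d / (enn2real (integral\<^sup>N M h) + 1))"
  have spos: "0 < s" unfolding s_def using d(1)
    by (subst ennreal_less_zero_iff) (intro divide_pos_pos add_nonneg_pos; simp)
  \<comment> \<open>Choosing the least admissible index makes \<open>x\<close> countably valued and
    measurable.\<close>
  define x where "x = (\<lambda>t. 1 / real (Suc (LEAST n. F t (ennreal (1 / Suc n)) \<le> s * h t)))"
  have [measurable]: "x \<in> borel_measurable M" unfolding x_def by measurable
  have "F t (ennreal \<bar>x t\<bar>) \<le> s * h t" if t: "t \<in> space M" for t
  proof -
    have "0 < s * h t" using spos hpos[OF t] by (simp add: ennreal_zero_less_mult_iff)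
    then have "\<exists>n::nat. F t (ennreal (1 / Suc n)) \<le> s * h t" by (rule small)
    from LeastI_ex[OF this] show ?thesis unfolding x_def by simp
  qed
  then have "modular_real M F x \<le> (\<integral>\<^sup>+t. s * h t \<partial>M)"
    unfolding modular_real_eq by (rule nn_integral_mono)
  also have "\<dots> = s * integral\<^sup>N M h" by (rule nn_integral_cmult) measurable
  also have "\<dots> = ennreal (d / (enn2real (integral\<^sup>N M h) + 1)) * ennreal (enn2real (integral\<^sup>N M h))"
    using hfin unfolding s_def by (simp add: less_top)
  also have "\<dots> = ennreal (d / (enn2real (integral\<^sup>N M h) + 1) * enn2real (integral\<^sup>N M h))"
    using d(1) by (subst ennreal_mult) auto
  also have "\<dots> \<le> ennreal d"
  proof (rule ennreal_leI)
    have "0 < enn2real (integral\<^sup>N M h) + 1" by (simp add: add_nonneg_pos)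
    then show "d / (enn2real (integral\<^sup>N M h) + 1) * enn2real (integral\<^sup>N M h) \<le> d"
      using d(1) by (simp add: pos_divide_le_eq)
  qed
  also have "\<dots> \<le> e" using d(2) by simp
  finally have "modular_real M F x \<le> e" .
  moreover have "0 < x t" for t unfolding x_def by simp
  ultimately show ?thesis using \<open>x \<in> borel_measurable M\<close> by (intro that[of x])
qed

end

subsection \<open>Consequences of an unattained Amemiya infimum\<close>

locale norm_not_attained = musielak_orlicz_space +
  fixes u :: "'a \<Rightarrow> real"
  assumes u_L: "u \<in> L_space M \<Phi>" and u_nz: "\<not> (AE t in M. u t = 0)"
    and K_empty: "K_set M \<Phi> u = {}"
begin

abbreviation "S \<equiv> supp M u"

lemma measurable_u [measurable]: "u \<in> borel_measurable M"
  using u_L by (rule L_measurable)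

lemma measurable_S [measurable]: "S \<in> sets M"
  unfolding supp_def by measurable

section \<open>The Amemiya expression of \<open>u\<close> as a function of \<open>k\<close>\<close>

lemma modular_scaled:
  "0 \<le> k \<Longrightarrow> I (\<lambda>t. k * u t) = (\<integral>\<^sup>+t. \<Phi> t (ennreal k * ennreal \<bar>u t\<bar>) \<partial>M)"
  unfolding modular_real_eq by (simp add: abs_mult ennreal_mult)

lemma modular_quotient:
  "0 \<le> k \<Longrightarrow> ennreal (1 / k) * I (\<lambda>t. k * u t)
    = (\<integral>\<^sup>+t. ennreal (1 / k) * \<Phi> t (ennreal k * ennreal \<bar>u t\<bar>) \<partial>M)"
  by (subst modular_scaled, simp, subst nn_integral_cmult) measurable

lemma modular_quotient_mono:
  assumes "0 < k" "k \<le> l"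
  shows "ennreal (1 / k) * I (\<lambda>t. k * u t) \<le> ennreal (1 / l) * I (\<lambda>t. l * u t)"
  using assms
  by (simp add: modular_quotient del: ennreal_1) (intro nn_integral_mono orlicz_function_quotient_mono orlicz; simp)

text \<open>Monotone convergence of the chord slopes to the asymptotic slope. The integral of
  \<open>b\<close> against the absolute value of \<open>u\<close> is thus the limit of the Amemiya
  expression as \<open>k\<close> grows.\<close>

lemma modular_quotient_SUP:
  "(SUP n::nat. ennreal (1 / Suc n) * I (\<lambda>t. Suc n * u t)) = (\<integral>\<^sup>+t. b t * ennreal \<bar>u t\<bar> \<partial>M)"
proof -
  have "(\<integral>\<^sup>+t. b t * ennreal \<bar>u t\<bar> \<partial>M)
      = (\<integral>\<^sup>+t. (SUP n::nat. ennreal (1 / Suc n) * \<Phi> t (ennreal (Suc n) * ennreal \<bar>u t\<bar>)) \<partial>M)"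
    by (subst b_fun_slope) (auto simp: orlicz)
  also have "\<dots> = (SUP n::nat. \<integral>\<^sup>+t. ennreal (1 / Suc n) * \<Phi> t (ennreal (Suc n) * ennreal \<bar>u t\<bar>) \<partial>M)"
  proof (rule nn_integral_monotone_convergence_SUP)
    show "incseq (\<lambda>n t. ennreal (1 / Suc n) * \<Phi> t (ennreal (Suc n) * ennreal \<bar>u t\<bar>))"
      by (intro incseq_SucI le_funI orlicz_function_quotient_mono orlicz) auto
  qed measurable
  finally show ?thesis by (subst modular_quotient) auto
qed

lemma amemiya_eq: "amemiya M \<Phi> u k = ennreal (1 / k) + ennreal (1 / k) * I (\<lambda>t. k * u t)"
  unfolding amemiya_def by (simp add: distrib_left)

text \<open>Fatou's lemma. Pointwise, a level exceeded at the limit argument is already exceeded at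
  a smaller rational, which the approximating arguments eventually pass.\<close>

lemma modular_lower_semicontinuous:
  assumes "l \<longlonglongrightarrow> k" "\<And>n. 0 \<le> l n" "0 \<le> k"
  shows "I (\<lambda>t. k * u t) \<le> liminf (\<lambda>n. I (\<lambda>t. l n * u t))"
proof -
  have "I (\<lambda>t. k * u t) \<le> (\<integral>\<^sup>+t. liminf (\<lambda>n. \<Phi> t (ennreal \<bar>l n * u t\<bar>)) \<partial>M)"
    unfolding modular_real_eq
  proof (rule nn_integral_mono)
    fix t
    show "\<Phi> t (ennreal \<bar>k * u t\<bar>) \<le> liminf (\<lambda>n. \<Phi> t (ennreal \<bar>l n * u t\<bar>))"
      unfolding le_Liminf_iff
    proof (intro allI impI)
      fix c assume "c < \<Phi> t (ennreal \<bar>k * u t\<bar>)"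
      then obtain q :: rat where q: "ennreal (of_rat q) < ennreal \<bar>k * u t\<bar>" "c < \<Phi> t (ennreal (of_rat q))"
        by (rule orlicz_function_left_approx[OF orlicz])
      have "(\<lambda>n. ennreal \<bar>l n * u t\<bar>) \<longlonglongrightarrow> ennreal \<bar>k * u t\<bar>"
        using assms(1) by (intro tendsto_intros)
      then have "eventually (\<lambda>n. ennreal (of_rat q) < ennreal \<bar>l n * u t\<bar>) sequentially"
        using q(1) by (rule order_tendstoD)
      then show "eventually (\<lambda>n. c < \<Phi> t (ennreal \<bar>l n * u t\<bar>)) sequentially"
        by eventually_elim
          (meson less_imp_le less_le_trans orlicz orlicz_function_mono q(2))
    qed
  qed
  also have "\<dots> \<le> liminf (\<lambda>n. I (\<lambda>t. l n * u t))"
    unfolding modular_real_eq by (intro nn_integral_liminf) measurable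
  finally show ?thesis .
qed

lemma amemiya_infimum_finite: "(INF l\<in>{0<..}. amemiya M \<Phi> u l) < \<infinity>"
proof -
  obtain c where c: "0 < c" "I (\<lambda>t. c * u t) < \<infinity>" using u_L unfolding L_space_def by auto
  have "(INF l\<in>{0<..}. amemiya M \<Phi> u l) \<le> amemiya M \<Phi> u c" using c by (intro INF_lower) simp
  also have "\<dots> < \<infinity>" unfolding amemiya_eq using c by (simp add: ennreal_mult_less_top)
  finally show ?thesis .
qed

text \<open>Otherwise a minimising sequence would stay in a bounded interval away from 0, and by
  lower semicontinuity a limit point would attain the infimum, contrary to
  \<open>K_empty\<close>.\<close>

lemma integral_b_le_infimum: "(\<integral>\<^sup>+t. b t * ennreal \<bar>u t\<bar> \<partial>M) \<le> (INF l\<in>{0<..}. amemiya M \<Phi> u l)"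
proof (rule ccontr)
  define m where "m = (INF l\<in>{0<..}. amemiya M \<Phi> u l)"
  assume "\<not> ?thesis"
  then have "m < (SUP n::nat. ennreal (1 / Suc n) * I (\<lambda>t. Suc n * u t))"
    unfolding modular_quotient_SUP m_def by simp
  then obtain N :: nat where N: "m < ennreal (1 / Suc N) * I (\<lambda>t. Suc N * u t)"
    unfolding less_SUP_iff by blast
  obtain m' where m': "m = ennreal m'" "0 \<le> m'"
    using amemiya_infimum_finite unfolding m_def[symmetric] by (cases m) auto
  have "\<exists>l>0. amemiya M \<Phi> u l < min (ennreal (m' + 1 / Suc n)) (ennreal (1 / Suc N) * I (\<lambda>t. Suc N * u t))" for n :: nat
  proof -
    have "m < ennreal (m' + 1 / Suc n)" using m' by (simp add: ennreal_less_iff)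
    then have "(INF l\<in>{0<..}. amemiya M \<Phi> u l) < min (ennreal (m' + 1 / Suc n)) (ennreal (1 / Suc N) * I (\<lambda>t. Suc N * u t))"
      using N unfolding m_def by simp
    then show ?thesis unfolding INF_less_iff by auto
  qed
  then obtain l where l: "\<And>n::nat. 0 < l n" "\<And>n. amemiya M \<Phi> u (l n) < ennreal (m' + 1 / Suc n)"
    "\<And>n. amemiya M \<Phi> u (l n) < ennreal (1 / Suc N) * I (\<lambda>t. Suc N * u t)"
    by (metis min_less_iff_conj)
  \<comment> \<open>Beyond \<open>Suc N\<close> the increasing modular quotient alone exceeds the
    value allowed to the sequence.\<close>
  have lN: "l n \<le> Suc N" for n
  proof (rule ccontr)
    assume "\<not> ?thesis"
    then have "ennreal (1 / Suc N) * I (\<lambda>t. Suc N * u t) \<le> ennreal (1 / l n) * I (\<lambda>t. l n * u t)"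
      by (intro modular_quotient_mono) auto
    also have "\<dots> \<le> amemiya M \<Phi> u (l n)" unfolding amemiya_eq by simp
    finally show False using l(3)[of n] by simp
  qed
  \<comment> \<open>Clearing the factor \<open>1 / l n\<close> gives a form that passes to the
    limit; its first half keeps the sequence away from 0.\<close>
  have bound: "1 \<le> l n * (m' + 1 / Suc n) \<and> I (\<lambda>t. l n * u t) \<le> ennreal (l n * (m' + 1 / Suc n) - 1)" for n
  proof -
    have "ennreal (l n) * amemiya M \<Phi> u (l n) \<le> ennreal (l n) * ennreal (m' + 1 / Suc n)"
      using l(2)[of n] by (intro mult_left_mono) auto
    moreover have "ennreal (l n) * amemiya M \<Phi> u (l n) = 1 + I (\<lambda>t. l n * u t)"
      unfolding amemiya_def using l(1)[of n]
      by (simp add: mult.assoc[symmetric] ennreal_mult[symmetric])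
    ultimately have *: "1 + I (\<lambda>t. l n * u t) \<le> ennreal (l n * (m' + 1 / Suc n))"
      using l(1)[of n] m'(2) by (simp add: ennreal_mult)
    then have "1 \<le> ennreal (l n * (m' + 1 / Suc n))" by (metis add_increasing2 order.trans order_refl zero_le)
    then have 1: "1 \<le> l n * (m' + 1 / Suc n)" by simp
    have "I (\<lambda>t. l n * u t) \<le> ennreal (l n * (m' + 1 / Suc n)) - ennreal 1"
      using * by (subst ennreal_le_minus_iff) (simp add: add.commute)
    then show ?thesis using 1 by (simp add: ennreal_minus del: ennreal_1)
  qed
  have "compact {0..real (Suc N)}" by simp
  then have "seq_compact {0..real (Suc N)}" by (simp add: compact_eq_seq_compact_metric)
  moreover have "\<forall>n. l n \<in> {0..real (Suc N)}" using l(1) lN by (auto intro: less_imp_le)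
  ultimately obtain k r where k: "k \<in> {0..real (Suc N)}" "strict_mono (r :: nat \<Rightarrow> nat)" "(l \<circ> r) \<longlonglongrightarrow> k"
    by (rule seq_compactE)
  have lim: "(\<lambda>n. (l \<circ> r) n * (m' + 1 / Suc (r n))) \<longlonglongrightarrow> k * (m' + 0)"
  proof (intro tendsto_intros k(3))
    have "(\<lambda>n. 1 / real (Suc n)) \<longlonglongrightarrow> 0" by (intro LIMSEQ_Suc lim_1_over_n)
    from LIMSEQ_subseq_LIMSEQ[OF this k(2)] show "(\<lambda>n. 1 / real (Suc (r n))) \<longlonglongrightarrow> 0" by (simp add: o_def)
  qed
  \<comment> \<open>This excludes \<open>k = 0\<close>, so the limit point is admissible in
    \<open>K_set\<close>.\<close>
  have "1 \<le> k * (m' + 0)"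
    by (rule LIMSEQ_le_const[OF lim]) (use bound in auto)
  then have 1: "1 \<le> k * m'" by simp
  then have kpos: "0 < k" using k(1) by (cases "k = 0") auto
  have "I (\<lambda>t. k * u t) \<le> liminf (\<lambda>n. I (\<lambda>t. (l \<circ> r) n * u t))"
    using k(1) less_imp_le[OF l(1)] by (intro modular_lower_semicontinuous[OF k(3)]) auto
  also have "\<dots> \<le> liminf (\<lambda>n. ennreal ((l \<circ> r) n * (m' + 1 / Suc (r n)) - 1))"
    using bound by (intro Liminf_mono always_eventually) auto
  also have "\<dots> = ennreal (k * (m' + 0) - 1)"
    by (intro lim_imp_Liminf tendsto_intros lim) simp
  finally have "1 + I (\<lambda>t. k * u t) \<le> ennreal 1 + ennreal (k * m' - 1)" by (simp add: add_left_mono)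
  also have "\<dots> = ennreal (k * m')" using 1 by (subst ennreal_plus[symmetric]) auto
  finally have "amemiya M \<Phi> u k \<le> ennreal (1 / k) * ennreal (k * m')"
    unfolding amemiya_def by (rule mult_left_mono) simp
  also have "\<dots> = m" using kpos m' by (simp add: ennreal_mult[symmetric])
  finally have "amemiya M \<Phi> u k = m"
    using kpos unfolding m_def by (intro antisym INF_lower) auto
  then have "k \<in> K_set M \<Phi> u" unfolding K_set_def m_def using kpos by simp
  then show False using K_empty by simp
qed

lemma integral_b_finite: "(\<integral>\<^sup>+t. b t * ennreal \<bar>u t\<bar> \<partial>M) < \<infinity>"
  using integral_b_le_infimum amemiya_infimum_finite by (rule order.strict_trans1)

text \<open>Equality would make \<open>k\<close> a minimiser.\<close>

lemma integral_b_less_amemiya: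
  assumes "0 < k"
  shows "(\<integral>\<^sup>+t. b t * ennreal \<bar>u t\<bar> \<partial>M) < amemiya M \<Phi> u k"
proof -
  have "(INF l\<in>{0<..}. amemiya M \<Phi> u l) \<le> amemiya M \<Phi> u k" using assms by (intro INF_lower) simp
  moreover have "(INF l\<in>{0<..}. amemiya M \<Phi> u l) \<noteq> amemiya M \<Phi> u k"
    using K_empty assms unfolding K_set_def by auto
  ultimately show ?thesis using integral_b_le_infimum by simp
qed

text \<open>Where \<open>b\<close> is infinite this is 0; by \<open>b_finite\<close> that happens
  only off \<open>S\<close>, up to a null set.\<close>

definition \<beta> :: "'a \<Rightarrow> real" where "\<beta> t = enn2real (b t)"

lemma measurable_beta [measurable]: "\<beta> \<in> borel_measurable M"
  unfolding \<beta>_def by measurable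

lemma b_finite: "AE t in M. t \<in> S \<longrightarrow> b t = ennreal (\<beta> t) \<and> 0 < \<beta> t"
proof -
  have "AE t in M. b t * ennreal \<bar>u t\<bar> \<noteq> \<infinity>"
    using integral_b_finite by (intro nn_integral_PInf_AE) auto
  then show ?thesis
  proof eventually_elim
    case (elim t)
    show ?case
    proof
      assume "t \<in> S"
      then have "b t < \<infinity>" using elim by (auto simp: supp_def ennreal_mult_eq_top_iff less_top)
      then show "b t = ennreal (\<beta> t) \<and> 0 < \<beta> t"
        unfolding \<beta>_def using b_fun_pos[of \<Phi> t, OF orlicz] by (auto simp: enn2real_positive_iff)
    qed
  qed
qed

definition b_modular :: ennreal where "b_modular = (\<integral>\<^sup>+t. \<Psi> t (b t * indicator S t) \<partial>M)"

text \<open>Fatou's lemma for the gaps \<open>G n\<close>, which tend to the conjugate at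
  \<open>b\<close> on \<open>S\<close>. Their integrals are at most 1 because the integral of
  \<open>b\<close> against the absolute value of \<open>u\<close> lies below every Amemiya
  value.\<close>

lemma b_modular_le_1: "b_modular \<le> 1"
proof -
  define G where "G = (\<lambda>(n::nat) t. ennreal (Suc n) * (b t * ennreal \<bar>u t\<bar>) - \<Phi> t (ennreal (Suc n) * ennreal \<bar>u t\<bar>))"
  have [measurable]: "G n \<in> borel_measurable M" for n unfolding G_def by measurable
  have "b_modular \<le> (\<integral>\<^sup>+t. liminf (\<lambda>n. G n t) \<partial>M)"
    unfolding b_modular_def
  proof (rule nn_integral_mono_AE)
    show "AE t in M. \<Psi> t (b t * indicator S t) \<le> liminf (\<lambda>n. G n t)"
      using b_finite
    proof eventually_elim
      case (elim t)
      show ?case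
      proof (cases "t \<in> S")
        case True
        define \<phi> where "\<phi> = (\<lambda>w. enn2real (\<Phi> t (ennreal w)))"
        have bt: "b t = ennreal (\<beta> t)" "0 \<le> \<beta> t" using elim True by auto
        have ut: "0 < \<bar>u t\<bar>" using True by (simp add: supp_def)
        have G: "G n t = ennreal (\<beta> t * (Suc n * \<bar>u t\<bar>) - enn2real (\<Phi> t (ennreal (Suc n * \<bar>u t\<bar>))))" for n
        proof -
          have "\<Phi> t (ennreal (Suc n * \<bar>u t\<bar>)) \<le> ennreal (\<beta> t) * ennreal (Suc n * \<bar>u t\<bar>)"
            using orlicz_function_le_b_fun[of \<Phi> t, OF orlicz, of "Suc n * \<bar>u t\<bar>"] bt by simp
          then have "\<Phi> t (ennreal (Suc n * \<bar>u t\<bar>)) < \<infinity>"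
            by (rule order.strict_trans1) (simp add: ennreal_mult_less_top)
          then have "\<Phi> t (ennreal (Suc n * \<bar>u t\<bar>)) = ennreal (\<phi> (Suc n * \<bar>u t\<bar>))"
            unfolding \<phi>_def by simp
          moreover have "ennreal (Suc n) * (b t * ennreal \<bar>u t\<bar>) = ennreal (\<beta> t * (Suc n * \<bar>u t\<bar>))"
            using bt by (simp add: ennreal_mult ac_simps del: of_nat_Suc)
          moreover have "ennreal (Suc n) * ennreal \<bar>u t\<bar> = ennreal (Suc n * \<bar>u t\<bar>)"
            by (rule ennreal_mult[symmetric]) auto
          ultimately have "G n t = ennreal (\<beta> t * (Suc n * \<bar>u t\<bar>)) - ennreal (\<phi> (Suc n * \<bar>u t\<bar>))"
            unfolding G_def by simp
          then show ?thesis unfolding \<phi>_def by (simp add: ennreal_minus del: of_nat_Suc)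
        qed
        have "filterlim (\<lambda>n. real (Suc n) * \<bar>u t\<bar>) at_top sequentially"
          using ut by (intro filterlim_at_top_mult_tendsto_pos[OF tendsto_const] filterlim_compose[OF filterlim_real_sequentially filterlim_Suc])
            auto
        from complementary_b_fun_tendsto[of \<Phi> t, OF orlicz bt this]
        have "(\<lambda>n. G n t) \<longlonglongrightarrow> \<Psi> t (b t)" unfolding G using bt by simp
        then have "liminf (\<lambda>n. G n t) = \<Psi> t (b t)" by (intro lim_imp_Liminf) auto
        then show ?thesis using True by simp
      qed simp
    qed
  qed
  also have "\<dots> \<le> liminf (\<lambda>n. \<integral>\<^sup>+t. G n t \<partial>M)" by (rule nn_integral_liminf) measurable
  also have "\<dots> \<le> 1"
  proof -
    have "(\<integral>\<^sup>+t. G n t \<partial>M) \<le> 1" for n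
    proof -
      let ?J = "\<integral>\<^sup>+t. b t * ennreal \<bar>u t\<bar> \<partial>M"
      have le: "\<Phi> t (ennreal (Suc n) * ennreal \<bar>u t\<bar>) \<le> ennreal (Suc n) * (b t * ennreal \<bar>u t\<bar>)" for t
        using orlicz_function_le_b_fun[of \<Phi> t, OF orlicz, of "Suc n * \<bar>u t\<bar>"]
        by (simp add: ennreal_mult ac_simps del: of_nat_Suc)
      have J: "(\<integral>\<^sup>+t. ennreal (Suc n) * (b t * ennreal \<bar>u t\<bar>) \<partial>M) = ennreal (Suc n) * ?J"
        by (rule nn_integral_cmult) measurable
      have "I (\<lambda>t. Suc n * u t) \<le> ennreal (Suc n) * ?J"
        unfolding J[symmetric] by (subst modular_scaled, simp) (intro nn_integral_mono le)
      also have "\<dots> < \<infinity>" using integral_b_finite by (simp add: ennreal_mult_less_top)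
      finally have fin: "I (\<lambda>t. Suc n * u t) < \<infinity>" .
      have "(\<integral>\<^sup>+t. G n t \<partial>M) = ennreal (Suc n) * ?J - I (\<lambda>t. Suc n * u t)"
        unfolding G_def J[symmetric] modular_scaled[OF of_nat_0_le_iff]
        by (rule nn_integral_diff) (use fin modular_scaled[of "Suc n"] le in auto)
      also have "\<dots> \<le> 1"
      proof -
        \<comment> \<open>Multiplying the Amemiya value at \<open>Suc n\<close> by
          \<open>Suc n\<close> leaves 1 plus the modular, and this 1 is the bound sought.\<close>
        have "ennreal (Suc n) * ?J \<le> ennreal (Suc n) * amemiya M \<Phi> u (Suc n)"
          using integral_b_less_amemiya[of "Suc n"] by (intro mult_left_mono) auto
        also have "\<dots> = 1 + I (\<lambda>t. Suc n * u t)"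
          unfolding amemiya_def
          by (subst mult.assoc[symmetric], subst ennreal_mult[symmetric]) auto
        finally show ?thesis using fin by (subst ennreal_minus_le_iff) (auto simp: add.commute)
      qed
      finally show ?thesis .
    qed
    then have "liminf (\<lambda>n. \<integral>\<^sup>+t. G n t \<partial>M) \<le> liminf (\<lambda>n. 1 :: ennreal)"
      by (intro Liminf_mono always_eventually) auto
    then show ?thesis by (simp add: Liminf_const)
  qed
  finally show ?thesis .
qed

subsection \<open>Support functionals\<close>

abbreviation "off \<equiv> space M - S"

lemma measurable_off [measurable]: "off \<in> sets M"
  by measurable

lemma u_eq_0_off: "t \<in> off \<Longrightarrow> u t = 0"
  unfolding supp_def by auto

text \<open>Because \<open>sgn 0 = 0\<close>, this vanishes off \<open>S\<close> without an
  indicator.\<close>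

definition v0 :: "'a \<Rightarrow> real" where "v0 t = sgn (u t) * \<beta> t"

lemma measurable_v0 [measurable]: "v0 \<in> borel_measurable M"
  unfolding v0_def by measurable

lemma v0_eq_b: "AE t in M. ennreal \<bar>v0 t\<bar> = b t * indicator S t"
  using b_finite AE_space
proof eventually_elim
  case (elim t)
  then show ?case by (cases "u t = 0") (auto simp: v0_def abs_mult abs_sgn_eq supp_def split: split_indicator)
qed

lemma modular_v0: "I' v0 = b_modular"
  unfolding modular_real_eq b_modular_def
  by (rule nn_integral_cong_AE) (use v0_eq_b in \<open>eventually_elim, simp\<close>)

lemma b_modular_finite: "b_modular < \<infinity>"
  using b_modular_le_1 by (rule order.strict_trans1) simp

lemma integrable_v0: "x \<in> L \<Longrightarrow> integrable M (\<lambda>t. x t * v0 t)"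
  using b_modular_finite by (intro integrable_L_mult) (auto simp: modular_v0)

lemma u_v0_eq: "u t * v0 t = \<beta> t * \<bar>u t\<bar>"
  unfolding v0_def by (simp add: abs_sgn mult.commute mult.left_commute)

lemma beta_nonneg [simp]: "0 \<le> \<beta> t"
  unfolding \<beta>_def by simp

text \<open>This turns out to be the Orlicz norm of \<open>u\<close>, by
  \<open>orlicz_norm_u\<close>.\<close>

definition u_norm where "u_norm = enn2real (\<integral>\<^sup>+t. b t * ennreal \<bar>u t\<bar> \<partial>M)"

lemma beta_u: "AE t in M. b t * ennreal \<bar>u t\<bar> = ennreal (\<beta> t * \<bar>u t\<bar>)"
  using b_finite AE_space
proof eventually_elim
  case (elim t)
  then show ?case by (cases "u t = 0") (auto simp: supp_def ennreal_mult)
qed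

lemma integral_u_v0: "(LINT t|M. u t * v0 t) = u_norm"
proof -
  have "(LINT t|M. \<beta> t * \<bar>u t\<bar>) = enn2real (\<integral>\<^sup>+t. ennreal (\<beta> t * \<bar>u t\<bar>) \<partial>M)"
    by (rule integral_eq_nn_integral) auto
  also have "(\<integral>\<^sup>+t. ennreal (\<beta> t * \<bar>u t\<bar>) \<partial>M) = (\<integral>\<^sup>+t. b t * ennreal \<bar>u t\<bar> \<partial>M)"
    by (rule nn_integral_cong_AE) (use beta_u in \<open>eventually_elim, simp\<close>)
  finally show ?thesis unfolding u_norm_def u_v0_eq .
qed

text \<open>Testing with \<open>v0\<close> gives one inequality. For the other, a \<open>v\<close>
  of finite conjugate modular is bounded by \<open>b\<close> in absolute value almost
  everywhere.\<close>

lemma orlicz_norm_u: "orlicz_norm M \<Phi> u = u_norm"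
proof (rule antisym)
  show "u_norm \<le> orlicz_norm M \<Phi> u"
    using orlicz_norm_upper[OF u_L measurable_v0] b_modular_le_1 modular_v0 integral_u_v0 by simp
  show "orlicz_norm M \<Phi> u \<le> u_norm"
  proof (rule orlicz_norm_least)
    fix v assume [measurable]: "v \<in> borel_measurable M" and v: "I' v \<le> 1"
    have "AE t in M. \<Psi> t (ennreal \<bar>v t\<bar>) \<noteq> \<infinity>"
      using v unfolding modular_real_eq by (intro nn_integral_PInf_AE) (auto simp: top_unique)
    then have "(\<integral>\<^sup>+t. ennreal \<bar>u t * v t\<bar> \<partial>M) \<le> (\<integral>\<^sup>+t. b t * ennreal \<bar>u t\<bar> \<partial>M)"
    proof (intro nn_integral_mono_AE, eventually_elim)
      case (elim t)
      then have "ennreal \<bar>v t\<bar> \<le> b t" by (intro le_b_fun) (simp add: less_top)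
      then show ?case
        using mult_right_mono[of "ennreal \<bar>v t\<bar>" "b t" "ennreal \<bar>u t\<bar>"]
        by (simp add: abs_mult ennreal_mult mult.commute)
    qed
    moreover have "ennreal \<bar>LINT t|M. u t * v t\<bar> \<le> (\<integral>\<^sup>+t. ennreal \<bar>u t * v t\<bar> \<partial>M)"
      using integral_norm_bound_ennreal[OF integrable_L_mult[OF u_L]] v
      by (simp add: le_less_trans)
    ultimately have "ennreal \<bar>LINT t|M. u t * v t\<bar> \<le> (\<integral>\<^sup>+t. b t * ennreal \<bar>u t\<bar> \<partial>M)" by simp
    then show "\<bar>LINT t|M. u t * v t\<bar> \<le> u_norm"
      unfolding u_norm_def using enn2real_mono[of "ennreal \<bar>LINT t|M. u t * v t\<bar>"] integral_b_finite by simp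
  qed
qed

lemma u_norm_pos: "0 < u_norm"
proof -
  have "(\<integral>\<^sup>+t. b t * ennreal \<bar>u t\<bar> \<partial>M) \<noteq> 0"
  proof
    assume "(\<integral>\<^sup>+t. b t * ennreal \<bar>u t\<bar> \<partial>M) = 0"
    then have "AE t in M. b t * ennreal \<bar>u t\<bar> = 0" by (subst (asm) nn_integral_0_iff_AE) auto
    then have "AE t in M. u t = 0"
    proof eventually_elim
      case (elim t)
      then show ?case using b_fun_pos[of \<Phi> t, OF orlicz] by auto
    qed
    then show False using u_nz by simp
  qed
  then show ?thesis unfolding u_norm_def using integral_b_finite
    by (auto simp: enn2real_positive_iff zero_less_iff_neq_zero)
qed

text \<open>The pairing with \<open>u\<close> sees only \<open>S\<close>, so \<open>v0\<close> may
  be changed off \<open>S\<close> as long as the modular stays at most 1. Second support functionals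
  arise this way.\<close>

lemma support_functional_of_modular_le_1:
  assumes "v \<in> borel_measurable M" "I' v \<le> 1" "\<And>t. t \<in> S \<Longrightarrow> v t = v0 t"
  shows "support_functional M \<Phi> u (functional v)"
proof (rule functional_support[OF assms(1,2) u_L])
  have "(LINT t|M. u t * v t) = (LINT t|M. u t * v0 t)"
  proof (rule Bochner_Integration.integral_cong[OF refl])
    fix t assume "t \<in> space M"
    then show "u t * v t = u t * v0 t" using assms(3)[of t] u_eq_0_off[of t] by (cases "t \<in> S") auto
  qed
  then show "(LINT t|M. u t * v t) = orlicz_norm M \<Phi> u" by (simp add: integral_u_v0 orlicz_norm_u)
qed (simp add: orlicz_norm_u u_norm_pos)

lemma support_functional_v0: "support_functional M \<Phi> u (functional v0)"
  using b_modular_le_1 by (intro support_functional_of_modular_le_1) (auto simp: modular_v0)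

section \<open>The upper estimate for an arbitrary support functional\<close>

definition off_modular :: "('a \<Rightarrow> real) \<Rightarrow> ennreal" where
  "off_modular x = (\<integral>\<^sup>+t. \<Phi> t (ennreal \<bar>x t\<bar>) * indicator off t \<partial>M)"

definition Psi_b :: "'a \<Rightarrow> real" where "Psi_b t = enn2real (\<Psi> t (b t * indicator S t))"

lemma measurable_Psi_b [measurable]: "Psi_b \<in> borel_measurable M"
  unfolding Psi_b_def by measurable

lemma Psi_b_nonneg [simp]: "0 \<le> Psi_b t"
  unfolding Psi_b_def by simp

lemma Psi_b_eq: "AE t in M. \<Psi> t (b t * indicator S t) = ennreal (Psi_b t)"
proof -
  have "AE t in M. \<Psi> t (b t * indicator S t) \<noteq> \<infinity>"
    using b_modular_finite unfolding b_modular_def by (intro nn_integral_PInf_AE) auto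
  then show ?thesis by eventually_elim (simp add: Psi_b_def less_top)
qed

lemma integral_Psi_b: "integrable M Psi_b" "(LINT t|M. Psi_b t) = enn2real b_modular"
proof -
  have *: "(\<integral>\<^sup>+t. ennreal (Psi_b t) \<partial>M) = b_modular"
    unfolding b_modular_def by (rule nn_integral_cong_AE) (use Psi_b_eq in \<open>eventually_elim, simp\<close>)
  then show "integrable M Psi_b" using b_modular_finite by (intro integrableI_nonneg) auto
  show "(LINT t|M. Psi_b t) = enn2real b_modular"
    using * by (subst integral_eq_nn_integral) auto
qed

lemma support_functional_add:
  assumes "support_functional M \<Phi> u f" "x \<in> L" "y \<in> L"
  shows "f (\<lambda>t. x t + y t) = f x + f y"
  using assms unfolding support_functional_def dual_space_def by simp

text \<open>Apply \<open>support_functional_le_modular\<close> to \<open>n * u + x\<close>. On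
  \<open>S\<close> the modular grows like \<open>n * u_norm\<close>, which cancels against
  \<open>f (n * u)\<close>; dominated convergence evaluates the remainder, and off \<open>S\<close>
  only \<open>x\<close> is left.\<close>

lemma support_functional_upper:
  assumes f: "support_functional M \<Phi> u f" and [measurable]: "x \<in> borel_measurable M" and fin: "I x < \<infinity>"
  shows "f x \<le> (LINT t|M. x t * v0 t) + (1 - enn2real b_modular) + enn2real (off_modular x)"
proof -
  have xL: "x \<in> L" by (rule in_L_if_modular_finite[OF assms(2) fin])
  define y where "y = (\<lambda>(n::nat) t. real n * u t + x t)"
  have [measurable]: "y n \<in> borel_measurable M" for n unfolding y_def by measurable
  define \<phi> where "\<phi> = (\<lambda>n t. indicator S t * enn2real (\<Phi> t (ennreal \<bar>y n t\<bar>)))"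
  have [measurable]: "\<phi> n \<in> borel_measurable M" for n unfolding \<phi>_def by measurable
  have xv: "integrable M (\<lambda>t. x t * v0 t)" by (rule integrable_v0[OF xL])
  have uv: "integrable M (\<lambda>t. \<beta> t * \<bar>u t\<bar>)" using integrable_v0[OF u_L] unfolding u_v0_eq .
  have xv_abs: "\<bar>x t * v0 t\<bar> = \<beta> t * \<bar>x t\<bar>" if "t \<in> S" for t
    using that by (auto simp: v0_def abs_mult supp_def abs_sgn_eq)
  have y_bound: "\<bar>\<bar>y n t\<bar> - real n * \<bar>u t\<bar>\<bar> \<le> \<bar>x t\<bar>" for n t
  proof -
    have "real n * \<bar>u t\<bar> = \<bar>real n * u t\<bar>" by (simp add: abs_mult)
    then show ?thesis unfolding y_def by linarith
  qed
  \<comment> \<open>The gap is nonnegative since \<open>b\<close> bounds the chord slopes, at most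
    \<open>Psi_b\<close> by Young's inequality, and tends to \<open>Psi_b\<close> since
    \<open>\<bar>y n t\<bar>\<close> tends to infinity on \<open>S\<close>.\<close>
  have fact: "AE t in M. t \<in> S \<longrightarrow> (\<forall>n. \<Phi> t (ennreal \<bar>y n t\<bar>) = ennreal (\<phi> n t)
      \<and> 0 \<le> \<beta> t * \<bar>y n t\<bar> - \<phi> n t \<and> \<beta> t * \<bar>y n t\<bar> - \<phi> n t \<le> Psi_b t)
      \<and> (\<lambda>n. \<beta> t * \<bar>y n t\<bar> - \<phi> n t) \<longlonglongrightarrow> Psi_b t"
    using b_finite Psi_b_eq
  proof eventually_elim
    case (elim t)
    show ?case
    proof (intro impI conjI allI)
      assume t: "t \<in> S"
      have bt: "b t = ennreal (\<beta> t)" "0 \<le> \<beta> t" using elim t by auto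
      have Pt: "\<Psi> t (ennreal (\<beta> t)) = ennreal (Psi_b t)" using elim t bt by simp
      show Phi_eq: "\<Phi> t (ennreal \<bar>y n t\<bar>) = ennreal (\<phi> n t)" for n
      proof -
        have "\<Phi> t (ennreal \<bar>y n t\<bar>) \<le> ennreal (\<beta> t) * ennreal \<bar>y n t\<bar>"
          using orlicz_function_le_b_fun[of \<Phi> t, OF orlicz, of "\<bar>y n t\<bar>"] bt by simp
        also have "\<dots> < \<infinity>" by (simp add: ennreal_mult_less_top)
        finally show ?thesis unfolding \<phi>_def using t by simp
      qed
      have nonneg: "0 \<le> \<beta> t * \<bar>y n t\<bar> - \<phi> n t" for n
        using b_fun_minus_nonneg[of \<Phi> t "\<beta> t" "\<bar>y n t\<bar>", OF orlicz bt] t unfolding \<phi>_def by simp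
      show "0 \<le> \<beta> t * \<bar>y n t\<bar> - \<phi> n t" for n by (rule nonneg)
      show "\<beta> t * \<bar>y n t\<bar> - \<phi> n t \<le> Psi_b t" for n
      proof -
        have "ennreal \<bar>y n t\<bar> * ennreal (\<beta> t) \<le> \<Phi> t (ennreal \<bar>y n t\<bar>) + \<Psi> t (ennreal (\<beta> t))"
          by (rule young_inequality) simp
        also have "\<dots> = ennreal (\<phi> n t + Psi_b t)"
          unfolding Phi_eq Pt by (rule ennreal_plus[symmetric]) (auto simp: \<phi>_def)
        finally have "ennreal (\<bar>y n t\<bar> * \<beta> t) \<le> ennreal (\<phi> n t + Psi_b t)" by (simp add: ennreal_mult)
        then have "\<bar>y n t\<bar> * \<beta> t \<le> \<phi> n t + Psi_b t"
          by (subst (asm) ennreal_le_iff) (auto simp: \<phi>_def)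
        then show ?thesis by (simp add: mult.commute)
      qed
      have "filterlim (\<lambda>n. \<bar>y n t\<bar>) at_top sequentially"
      proof (rule filterlim_at_top_mono)
        have "filterlim (\<lambda>n. \<bar>u t\<bar> * real n) at_top sequentially"
          using t by (intro filterlim_tendsto_pos_mult_at_top[OF tendsto_const] filterlim_real_sequentially) (simp add: supp_def)
        then show "filterlim (\<lambda>n. - \<bar>x t\<bar> + \<bar>u t\<bar> * real n) at_top sequentially"
          by (rule filterlim_tendsto_add_at_top[OF tendsto_const])
        show "eventually (\<lambda>n. - \<bar>x t\<bar> + \<bar>u t\<bar> * real n \<le> \<bar>y n t\<bar>) sequentially"
          using y_bound[of _ t] by (intro always_eventually allI) (smt (verit) mult.commute)
      qed
      from complementary_b_fun_tendsto_real[of \<Phi> t "\<beta> t", OF orlicz bt _ this]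
      show "(\<lambda>n. \<beta> t * \<bar>y n t\<bar> - \<phi> n t) \<longlonglongrightarrow> Psi_b t"
        using t Pt unfolding \<phi>_def by simp
    qed
  qed
  \<comment> \<open>The subtracted term integrates to \<open>n * u_norm\<close>, so \<open>R\<close>
    is the part of the modular that stays bounded in \<open>n\<close>.\<close>
  define R where "R = (\<lambda>n t. \<phi> n t - real n * (\<beta> t * \<bar>u t\<bar>))"
  have [measurable]: "R n \<in> borel_measurable M" for n unfolding R_def by measurable
  have R_bound: "AE t in M. norm (R n t) \<le> \<bar>x t * v0 t\<bar> + Psi_b t" for n
    using fact AE_space
  proof eventually_elim
    case (elim t)
    show ?case
    proof (cases "t \<in> S")
      case True
      have "R n t = \<beta> t * (\<bar>y n t\<bar> - real n * \<bar>u t\<bar>) - (\<beta> t * \<bar>y n t\<bar> - \<phi> n t)"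
        unfolding R_def by (simp add: algebra_simps)
      moreover have "\<bar>\<beta> t * (\<bar>y n t\<bar> - real n * \<bar>u t\<bar>)\<bar> \<le> \<beta> t * \<bar>x t\<bar>"
        using mult_left_mono[OF y_bound[of n t] beta_nonneg[of t]] by (simp add: abs_mult)
      moreover have "0 \<le> \<beta> t * \<bar>y n t\<bar> - \<phi> n t \<and> \<beta> t * \<bar>y n t\<bar> - \<phi> n t \<le> Psi_b t"
        using elim True by blast
      ultimately show ?thesis using xv_abs[OF True] unfolding real_norm_def by linarith
    next
      case False
      then have "R n t = 0" using u_eq_0_off[of t] elim unfolding R_def \<phi>_def by simp
      then show ?thesis by simp
    qed
  qed
  have R_lim: "AE t in M. (\<lambda>n. R n t) \<longlonglongrightarrow> x t * v0 t - Psi_b t"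
    using fact AE_space
  proof eventually_elim
    case (elim t)
    show ?case
    proof (cases "t \<in> S")
      case True
      \<comment> \<open>From \<open>m\<close> on, \<open>n * u t\<close> outweighs
        \<open>x t\<close>, so \<open>y n t\<close> cannot have the sign opposite to
        \<open>u t\<close> and the difference of absolute values is exactly
        \<open>sgn (u t) * x t\<close>.\<close>
      obtain m :: nat where m: "\<bar>x t\<bar> / \<bar>u t\<bar> \<le> real m" using real_arch_simple by blast
      have u0: "u t \<noteq> 0" using True by (simp add: supp_def)
      have "\<beta> t * (\<bar>y n t\<bar> - real n * \<bar>u t\<bar>) = x t * v0 t" if n: "m \<le> n" for n
      proof -
        have "\<bar>x t\<bar> \<le> real m * \<bar>u t\<bar>" using m u0 by (simp add: pos_divide_le_eq)
        also have "\<dots> \<le> real n * \<bar>u t\<bar>" using n by (intro mult_right_mono) auto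
        finally have "\<bar>y n t\<bar> - real n * \<bar>u t\<bar> = sgn (u t) * x t"
          unfolding y_def using u0 by (cases "u t > 0") (auto simp: sgn_if)
        then show ?thesis by (simp add: v0_def)
      qed
      then have "(\<lambda>n. \<beta> t * (\<bar>y n t\<bar> - real n * \<bar>u t\<bar>)) \<longlonglongrightarrow> x t * v0 t"
        by (intro tendsto_eventually eventually_sequentiallyI[of m]) auto
      then have "(\<lambda>n. \<beta> t * (\<bar>y n t\<bar> - real n * \<bar>u t\<bar>) - (\<beta> t * \<bar>y n t\<bar> - \<phi> n t)) \<longlonglongrightarrow> x t * v0 t - Psi_b t"
        using elim True by (intro tendsto_diff) auto
      moreover have "R n t = \<beta> t * (\<bar>y n t\<bar> - real n * \<bar>u t\<bar>) - (\<beta> t * \<bar>y n t\<bar> - \<phi> n t)" for n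
        unfolding R_def by (simp add: algebra_simps)
      ultimately show ?thesis by simp
    next
      case False
      then have "R n t = 0" for n using u_eq_0_off[of t] elim unfolding R_def \<phi>_def by simp
      moreover have "x t * v0 t - Psi_b t = 0"
        using u_eq_0_off[of t] elim False by (simp add: v0_def Psi_b_def)
      ultimately show ?thesis by (simp only: tendsto_const)
    qed
  qed
  have lim: "(\<lambda>n. LINT t|M. R n t) \<longlonglongrightarrow> (LINT t|M. x t * v0 t - Psi_b t)"
    by (rule integral_dominated_convergence[where w = "\<lambda>t. \<bar>x t * v0 t\<bar> + Psi_b t"])
      (use xv integral_Psi_b R_lim R_bound in auto)
  have Rint: "integrable M (R n)" for n
    by (rule Bochner_Integration.integrable_bound[where f = "\<lambda>t. \<bar>x t * v0 t\<bar> + Psi_b t"])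
      (use xv integral_Psi_b R_bound[of n] in auto)
  have bound: "f x \<le> 1 + (LINT t|M. R n t) + enn2real (off_modular x)" for n
  proof -
    have phi_int: "integrable M (\<phi> n)"
    proof -
      have "integrable M (\<lambda>t. R n t + real n * (\<beta> t * \<bar>u t\<bar>))" using Rint uv by auto
      then show ?thesis unfolding R_def by simp
    qed
    \<comment> \<open>On \<open>S\<close> the integrand is \<open>\<phi> n\<close>; off
      \<open>S\<close> the function \<open>u\<close> vanishes and \<open>y n\<close> equals
      \<open>x\<close>.\<close>
    have "I (y n) = (\<integral>\<^sup>+t. ennreal (\<phi> n t) + \<Phi> t (ennreal \<bar>x t\<bar>) * indicator off t \<partial>M)"
      unfolding modular_real_eq
    proof (rule nn_integral_cong_AE, use fact AE_space in eventually_elim)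
      case (elim t)
      then show ?case using u_eq_0_off[of t] by (cases "t \<in> S") (auto simp: \<phi>_def y_def)
    qed
    also have "\<dots> = (\<integral>\<^sup>+t. ennreal (\<phi> n t) \<partial>M) + off_modular x"
      unfolding off_modular_def by (rule nn_integral_add) auto
    also have "(\<integral>\<^sup>+t. ennreal (\<phi> n t) \<partial>M) = ennreal (LINT t|M. \<phi> n t)"
      by (rule nn_integral_eq_integral[OF phi_int]) (simp add: \<phi>_def)
    finally have I_y: "I (y n) = ennreal (LINT t|M. \<phi> n t) + off_modular x" .
    have "off_modular x \<le> I x"
      unfolding off_modular_def modular_real_eq by (intro nn_integral_mono) (simp split: split_indicator)
    then have off_fin: "off_modular x < \<infinity>" using fin by (rule order.strict_trans1)
    then have "I (y n) < \<infinity>" using I_y by simp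
    moreover have "enn2real (I (y n)) = (LINT t|M. \<phi> n t) + enn2real (off_modular x)"
      using off_fin unfolding I_y by (subst enn2real_plus) (auto intro!: integral_nonneg_AE simp: \<phi>_def)
    ultimately have "f (y n) \<le> 1 + ((LINT t|M. \<phi> n t) + enn2real (off_modular x))"
      using support_functional_le_modular[OF f, of "y n"] by simp
    moreover have "f (y n) = real n * u_norm + f x"
    proof -
      have "f (\<lambda>t. real n * u t) = real n * f u" "f u = u_norm"
        using f u_L unfolding support_functional_def dual_space_def orlicz_norm_u by blast+
      moreover have "f (\<lambda>t. real n * u t + x t) = f (\<lambda>t. real n * u t) + f x"
        by (rule support_functional_add[OF f L_scale[OF u_L] xL])
      ultimately show ?thesis unfolding y_def by simp
    qed
    moreover have "(LINT t|M. R n t) = (LINT t|M. \<phi> n t) - real n * u_norm"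
      unfolding R_def using phi_int uv integral_u_v0 unfolding u_v0_eq by simp
    ultimately show ?thesis by simp
  qed
  have "(\<lambda>n. 1 + (LINT t|M. R n t) + enn2real (off_modular x))
      \<longlonglongrightarrow> 1 + (LINT t|M. x t * v0 t - Psi_b t) + enn2real (off_modular x)"
    by (intro tendsto_intros lim)
  then have "f x \<le> 1 + (LINT t|M. x t * v0 t - Psi_b t) + enn2real (off_modular x)"
    by (rule LIMSEQ_le_const) (use bound in auto)
  also have "(LINT t|M. x t * v0 t - Psi_b t) = (LINT t|M. x t * v0 t) - enn2real b_modular"
    using xv integral_Psi_b by simp
  finally show ?thesis by simp
qed

lemma support_functional_upper_scaled:
  assumes f: "support_functional M \<Phi> u f" and x: "x \<in> L" and fin: "I (\<lambda>t. c * x t) < \<infinity>"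
  shows "c * (f x - (LINT t|M. x t * v0 t)) \<le> (1 - enn2real b_modular) + enn2real (off_modular (\<lambda>t. c * x t))"
proof -
  have "f (\<lambda>t. c * x t) = c * f x"
    using f x unfolding support_functional_def dual_space_def by blast
  moreover have "(LINT t|M. c * x t * v0 t) = c * (LINT t|M. x t * v0 t)"
    by (simp add: mult.assoc)
  ultimately show ?thesis
    using support_functional_upper[OF f _ fin] L_measurable[OF x] by (simp add: algebra_simps)
qed

text \<open>The constant term of the upper estimate vanishes. Dividing by the scaling factor leaves
  chord slopes of \<open>\<Phi>\<close> at 0 off \<open>S\<close>, which decrease to 0 because the
  conjugate has zero threshold \<open>a_fun\<close> there.\<close>

lemma support_functional_le_v0_i:
  assumes f: "support_functional M \<Phi> u f" and x: "x \<in> L"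
    and b_modular: "b_modular = 1" and a: "AE t in M. a_fun \<Psi> t * indicator off t = 0"
  shows "f x \<le> (LINT t|M. x t * v0 t)"
proof (rule ccontr)
  assume "\<not> ?thesis"
  then have d: "0 < f x - (LINT t|M. x t * v0 t)" (is "0 < ?d") by simp
  obtain c where c: "0 < c" "I (\<lambda>t. c * x t) < \<infinity>" using x unfolding L_space_def by auto
  note [measurable] = L_measurable[OF x]
  define z where "z = (\<lambda>t. c * x t)"
  have [measurable]: "z \<in> borel_measurable M" unfolding z_def by measurable
  \<comment> \<open>Scaling by \<open>c / Suc n\<close> and clearing the factor
    \<open>1 / Suc n\<close> turns the estimate into a bound of \<open>c * ?d\<close> by the
    integral of \<open>e n\<close>. These decrease from the integrable \<open>e 0\<close>.\<close>
  define e where "e = (\<lambda>(n::nat) t. ennreal (Suc n) * \<Phi> t (ennreal (1 / Suc n) * ennreal \<bar>z t\<bar>) * indicator off t)"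
  have [measurable]: "e n \<in> borel_measurable M" for n unfolding e_def by measurable
  have z_fin: "AE t in M. \<Phi> t (ennreal \<bar>z t\<bar>) \<noteq> \<infinity>"
    using c(2) unfolding modular_real_eq z_def by (intro nn_integral_PInf_AE) auto
  have e_int: "integral\<^sup>N M (e n) = ennreal (Suc n) * off_modular (\<lambda>t. 1 / Suc n * z t)" for n
  proof -
    have "e n = (\<lambda>t. ennreal (Suc n) * (\<Phi> t (ennreal \<bar>1 / Suc n * z t\<bar>) * indicator off t))"
      unfolding e_def by (simp only: abs_mult ennreal_mult abs_ge_zero mult.assoc) simp
    then show ?thesis unfolding off_modular_def by (simp only:) (rule nn_integral_cmult, measurable)
  qed
  have fin: "I (\<lambda>t. 1 / Suc n * z t) < \<infinity>" for n
  proof -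
    have "I (\<lambda>t. 1 / Suc n * z t) \<le> I z"
      by (rule modular_real_mono) (simp add: abs_mult divide_le_eq mult_le_cancel_left1)
    then show ?thesis using c(2) unfolding z_def by (rule order.strict_trans1)
  qed
  have off_le: "off_modular w \<le> I w" for w
    unfolding off_modular_def modular_real_eq by (intro nn_integral_mono) (simp split: split_indicator)
  have e_fin: "integral\<^sup>N M (e n) < \<infinity>" for n
    unfolding e_int using order.strict_trans1[OF off_le fin] by (simp add: ennreal_mult_less_top)
  have "(\<integral>\<^sup>+t. (INF n. e n t) \<partial>M) = 0"
  proof (subst nn_integral_0_iff_AE)
    show "AE t in M. (INF n. e n t) = 0"
      using a z_fin
    proof eventually_elim
      case (elim t)
      then show ?case
        using a_fun_zero_slope[of \<Phi> t "\<bar>z t\<bar>", OF orlicz] unfolding e_def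
        by (auto simp: less_top split: split_indicator)
    qed
  qed measurable
  moreover have "(\<integral>\<^sup>+t. (INF n. e n t) \<partial>M) = (INF n. integral\<^sup>N M (e n))"
  proof (rule nn_integral_monotone_convergence_INF_AE')
    show "AE t in M. e (Suc n) t \<le> e n t" for n
    proof (rule AE_I2)
      fix t
      show "e (Suc n) t \<le> e n t"
        using orlicz_function_quotient_mono[of "\<Phi> t" "1 / Suc (Suc n)" "1 / Suc n" "ennreal \<bar>z t\<bar>", OF orlicz]
        unfolding e_def by (intro mult_right_mono) (auto simp: field_simps)
    qed
    show "integral\<^sup>N M (e 0) < \<infinity>" by (rule e_fin)
  qed measurable
  ultimately have "(INF n. integral\<^sup>N M (e n)) < ennreal (c * ?d)"
    using c d by (simp add: ennreal_less_zero_iff)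
  then obtain n where n: "integral\<^sup>N M (e n) < ennreal (c * ?d)" unfolding INF_less_iff by blast
  have eq: "(\<lambda>t. c / Suc n * x t) = (\<lambda>t. 1 / Suc n * z t)" unfolding z_def by simp
  have "c / Suc n * ?d \<le> enn2real (off_modular (\<lambda>t. c / Suc n * x t))"
    using support_functional_upper_scaled[OF f x, of "c / Suc n"] fin[of n] b_modular unfolding eq by simp
  then have "c * ?d \<le> Suc n * enn2real (off_modular (\<lambda>t. 1 / Suc n * z t))"
    unfolding eq by (simp add: field_simps)
  also have "\<dots> = enn2real (integral\<^sup>N M (e n))"
    unfolding e_int by (simp add: enn2real_mult del: of_nat_Suc)
  also have "\<dots> < c * ?d"
    using n e_fin[of n] c d by (subst ennreal_less_iff[symmetric]) auto
  finally show False by simp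
qed

text \<open>Without mass off \<open>S\<close> the upper estimate is a constant, and all multiples of
  \<open>x\<close> are admissible, so a positive difference could be multiplied beyond that
  constant.\<close>

lemma support_functional_le_v0_ii:
  assumes f: "support_functional M \<Phi> u f" and x: "x \<in> L" and off: "emeasure M off = 0"
  shows "f x \<le> (LINT t|M. x t * v0 t)"
proof (rule ccontr)
  assume "\<not> ?thesis"
  then have d: "0 < f x - (LINT t|M. x t * v0 t)" (is "0 < ?d") by simp
  note [measurable] = L_measurable[OF x]
  have ae_S: "AE t in M. t \<in> S"
    using off by (intro AE_I[of _ _ off]) (auto simp: supp_def)
  have off0: "off_modular w = 0" for w
  proof -
    have "off_modular w = (\<integral>\<^sup>+t. 0 \<partial>M)"
      unfolding off_modular_def by (rule nn_integral_cong_AE) (use ae_S in \<open>eventually_elim, simp\<close>)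
    then show ?thesis by simp
  qed
  \<comment> \<open>The asymptotic slope bounds the modular of every multiple by an integral of
    \<open>x * v0\<close>, which is finite.\<close>
  have fin: "I (\<lambda>t. real n * x t) < \<infinity>" for n :: nat
  proof -
    have "I (\<lambda>t. real n * x t) \<le> (\<integral>\<^sup>+t. ennreal (norm (real n * (x t * v0 t))) \<partial>M)"
      unfolding modular_real_eq
    proof (rule nn_integral_mono_AE, use ae_S b_finite in eventually_elim)
      case (elim t)
      then have "\<bar>v0 t\<bar> = \<beta> t" by (simp add: v0_def abs_mult abs_sgn_eq supp_def)
      then show ?case
        using orlicz_function_le_b_fun[of \<Phi> t, OF orlicz, of "\<bar>real n * x t\<bar>"] elim
        by (simp add: abs_mult ennreal_mult ac_simps)
    qed
    also have "\<dots> < \<infinity>"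
      using iffD1[OF integrable_iff_bounded, OF integrable_mult_right[OF integrable_v0[OF x]]] by blast
    finally show ?thesis .
  qed
  have bound: "real n * ?d \<le> 1" for n
  proof -
    have "real n * ?d \<le> 1 - enn2real b_modular"
      using support_functional_upper_scaled[OF f x fin] off0 by simp
    then show ?thesis using enn2real_nonneg[of b_modular] by linarith
  qed
  obtain n :: nat where "1 < real n * ?d" using d reals_Archimedean3 by blast
  then show False using bound[of n] by simp
qed

section \<open>Smoothness in both directions\<close>

lemma smooth_if:
  assumes "b_modular = 1 \<and> (AE t in M. a_fun \<Psi> t * indicator off t = 0) \<or> emeasure M off = 0"
  shows "smooth_point M \<Phi> u"
  unfolding smooth_point_def nonzero_element_def
proof (intro conjI ex1I[of _ "functional v0"] u_L u_nz support_functional_v0)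
  fix f assume f: "support_functional M \<Phi> u f"
  have le: "f x \<le> (LINT t|M. x t * v0 t)" if "x \<in> L" for x
    using assms support_functional_le_v0_i[OF f that] support_functional_le_v0_ii[OF f that] by blast
  show "f = functional v0"
  proof (rule extensionalityI)
    show "f \<in> extensional L" using f unfolding support_functional_def dual_space_def by blast
    show "functional v0 \<in> extensional L" unfolding functional_def by simp
    fix x assume x: "x \<in> L"
    \<comment> \<open>A linear functional dominated by another one equals it: use the domination at
      \<open>- x\<close> too.\<close>
    have "f (\<lambda>t. - 1 * x t) = - 1 * f x"
      using f x unfolding support_functional_def dual_space_def by blast
    then have "f x = (LINT t|M. x t * v0 t)"
      using le[OF x] le[OF L_scale[OF x, of "- 1"]] by simp
    then show "f x = functional v0 x" unfolding functional_def using x by simp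
  qed
qed

text \<open>Adding \<open>w\<close> to \<open>v0\<close> off \<open>S\<close> gives another support
  functional. Smoothness identifies the two, and a strictly positive test function then forces
  \<open>w\<close> to vanish there.\<close>

lemma perturbation_off_null:
  assumes smooth: "smooth_point M \<Phi> u"
    and [measurable]: "w \<in> borel_measurable M" and w_nonneg: "\<And>t. 0 \<le> w t"
    and w_mod: "b_modular + (\<integral>\<^sup>+t. \<Psi> t (ennreal (w t)) * indicator off t \<partial>M) \<le> 1"
  shows "AE t in M. t \<in> off \<longrightarrow> w t = 0"
proof -
  define v where "v = (\<lambda>t. v0 t + w t * indicator off t)"
  have [measurable]: "v \<in> borel_measurable M" unfolding v_def by measurable
  \<comment> \<open>The two summands of \<open>v\<close> have disjoint supports, so their modulars
    add.\<close>
  have "I' v = (\<integral>\<^sup>+t. \<Psi> t (ennreal \<bar>v0 t\<bar>) + \<Psi> t (ennreal (w t)) * indicator off t \<partial>M)"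
    unfolding modular_real_eq
  proof (rule nn_integral_cong)
    fix t assume "t \<in> space M"
    then show "\<Psi> t (ennreal \<bar>v t\<bar>) = \<Psi> t (ennreal \<bar>v0 t\<bar>) + \<Psi> t (ennreal (w t)) * indicator off t"
      using u_eq_0_off[of t] w_nonneg[of t] by (cases "t \<in> S") (auto simp: v_def v0_def)
  qed
  also have "\<dots> = I' v0 + (\<integral>\<^sup>+t. \<Psi> t (ennreal (w t)) * indicator off t \<partial>M)"
    unfolding modular_real_eq by (intro nn_integral_add) measurable
  finally have I_v: "I' v \<le> 1" using w_mod by (simp add: modular_v0)
  have "support_functional M \<Phi> u (functional v)"
    using I_v by (intro support_functional_of_modular_le_1) (auto simp: v_def)
  then have eq: "functional v = functional v0"
    using smooth support_functional_v0 unfolding smooth_point_def by blast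
  \<comment> \<open>Positivity everywhere is what lets a single element of \<open>L\<close> detect
    \<open>w\<close>.\<close>
  obtain x where x [measurable]: "x \<in> borel_measurable M" "\<And>t. 0 < x t" "I x \<le> 1"
    by (rule exists_pos_small_modular[of \<Phi> 1, OF _ orlicz_function_small[OF orlicz]])
      (auto intro: measurable_Phi)
  have xL: "x \<in> L" using x(1,3) by (intro in_L_if_modular_finite) (auto simp: le_less_trans)
  have int: "integrable M (\<lambda>t. x t * v t)" "integrable M (\<lambda>t. x t * v0 t)"
    using I_v by (auto intro!: integrable_L_mult[OF xL] integrable_v0[OF xL] simp: le_less_trans)
  have diff: "x t * v t - x t * v0 t = x t * (w t * indicator off t)" for t
    unfolding v_def by (simp add: algebra_simps)
  have "(LINT t|M. x t * v t) = (LINT t|M. x t * v0 t)"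
    using fun_cong[OF eq, of x] xL unfolding functional_def by simp
  then have "(LINT t|M. x t * v t - x t * v0 t) = 0" using int by simp
  then have "(LINT t|M. x t * (w t * indicator off t)) = 0" unfolding diff .
  moreover have "integrable M (\<lambda>t. x t * (w t * indicator off t))"
    using Bochner_Integration.integrable_diff[OF int] unfolding diff .
  ultimately have "AE t in M. x t * (w t * indicator off t) = 0"
    using x(2) w_nonneg by (subst (asm) integral_nonneg_eq_0_iff_AE) (auto intro!: AE_I2 mult_nonneg_nonneg simp: less_imp_le)
  then show ?thesis
  proof eventually_elim
    case (elim t)
    then show ?case using x(2)[of t] by (auto split: split_indicator_asm)
  qed
qed

lemma smooth_only_if:
  assumes smooth: "smooth_point M \<Phi> u"
  shows "b_modular = 1 \<and> (AE t in M. a_fun \<Psi> t * indicator off t = 0) \<or> b_modular < 1 \<and> emeasure M off = 0"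
proof (cases "b_modular = 1")
  case True
  \<comment> \<open>Halving puts \<open>w\<close> strictly below a positive finite threshold, where
    the conjugate vanishes; the minimum with 1 keeps it real when the threshold is infinite. Such a
    perturbation costs no modular.\<close>
  define w where "w = (\<lambda>t. enn2real (min 1 (a_fun \<Psi> t / 2)))"
  have [measurable]: "w \<in> borel_measurable M" unfolding w_def by measurable
  have w: "ennreal (w t) = min 1 (a_fun \<Psi> t / 2)" for t
  proof -
    have "min 1 (a_fun \<Psi> t / 2) \<le> 1" by simp
    also have "\<dots> < \<infinity>" by simp
    finally show ?thesis unfolding w_def by simp
  qed
  have "\<Psi> t (ennreal (w t)) = 0" for t
  proof (cases "a_fun \<Psi> t = 0")
    case True
    then show ?thesis by (simp add: w)
  next
    case False
    have "ennreal (w t) < a_fun \<Psi> t"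
    proof (cases "a_fun \<Psi> t")
      case (real r)
      then have "a_fun \<Psi> t / 2 = ennreal (r / 2)"
        by (metis divide_ennreal ennreal_numeral zero_le_numeral zero_less_numeral)
      moreover have "ennreal (r / 2) < ennreal r" using real False by (auto simp: ennreal_less_iff)
      ultimately show ?thesis using real unfolding w by (simp add: min_less_iff_disj)
    next
      case top
      then show ?thesis unfolding w by (simp add: min_less_iff_disj)
    qed
    then show ?thesis by (rule complementary_zero_below_a_fun)
  qed
  then have "AE t in M. t \<in> off \<longrightarrow> w t = 0"
    using True by (intro perturbation_off_null[OF smooth]) (auto simp: w_def)
  then have "AE t in M. a_fun \<Psi> t * indicator off t = 0"
  proof eventually_elim
    case (elim t)
    have "a_fun \<Psi> t = 0" if "w t = 0"
    proof -
      have "min 1 (a_fun \<Psi> t / 2) = 0" using w[of t] that by simp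
      then show ?thesis by (auto simp: min_def ennreal_divide_eq_0_iff split: if_splits)
    qed
    then show ?case using elim by (auto split: split_indicator)
  qed
  with True show ?thesis by blast
next
  case False
  then have b_modular: "b_modular < 1" using b_modular_le_1 by simp
  \<comment> \<open>This slack pays for an everywhere positive perturbation, which can vanish off
    \<open>S\<close> only if that set is null.\<close>
  then have pos: "0 < 1 - b_modular" by (rule diff_gr0_ennreal)
  have "(\<lambda>t. \<Psi> t (ennreal (1 / Suc n))) \<in> borel_measurable M" for n by measurable
  then obtain w where w [measurable]: "w \<in> borel_measurable M"
    and w_pos: "\<And>t. 0 < w t" and w_mod: "I' w \<le> 1 - b_modular"
    using exists_pos_small_modular[of \<Psi>, OF _ complementary_small[of \<Phi>, OF orlicz] pos] by auto
  have "(\<integral>\<^sup>+t. \<Psi> t (ennreal (w t)) * indicator off t \<partial>M) \<le> I' w"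
    unfolding modular_real_eq using w_pos
    by (intro nn_integral_mono) (simp add: less_imp_le split: split_indicator)
  also have "\<dots> \<le> 1 - b_modular" by (rule w_mod)
  finally have "b_modular + (\<integral>\<^sup>+t. \<Psi> t (ennreal (w t)) * indicator off t \<partial>M) \<le> b_modular + (1 - b_modular)"
    by (rule add_left_mono)
  also have "\<dots> = 1" using b_modular by (simp add: add_diff_self_ennreal)
  finally have "AE t in M. t \<in> off \<longrightarrow> w t = 0"
    using w_pos by (intro perturbation_off_null[OF smooth]) (auto intro: less_imp_le)
  then have "AE t in M. t \<notin> off" 
  proof eventually_elim
    case (elim t)
    then show ?case using w_pos[of t] by auto
  qed
  then have "emeasure M off = 0"
    using AE_iff_measurable[of off M "\<lambda>t. t \<notin> off"] by (auto intro: AE_E simp: set_diff_eq)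
  with b_modular show ?thesis by blast
qed

text \<open>If the complement of the support is null, cutting \<open>b\<close> off to
  \<open>S\<close> changes nothing almost everywhere; this converts the second alternative.\<close>

lemma smooth_iff:
  "smooth_point M \<Phi> u \<longleftrightarrow>
      (modular M \<Psi> (\<lambda>t. b t * indicator S t) = 1 \<and> (AE t in M. a_fun \<Psi> t * indicator off t = 0))
    \<or> (modular M \<Psi> b < 1 \<and> emeasure M off = 0)"
proof -
  have b_modular: "modular M \<Psi> (\<lambda>t. b t * indicator S t) = b_modular" unfolding modular_def b_modular_def ..
  have "modular M \<Psi> b = b_modular" if "emeasure M off = 0"
  proof -
    have "AE t in M. t \<in> S"
      using that by (intro AE_I[of _ _ off]) (auto simp: supp_def)
    then show ?thesis
      unfolding modular_def b_modular_def
      by (intro nn_integral_cong_AE, elim eventually_mono) simp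
  qed
  then show ?thesis unfolding b_modular using smooth_if smooth_only_if by auto
qed

end

section \<open>Passage from almost every point to every point\<close>

lemma orlicz_function_id: "orlicz_function (\<lambda>x. x)"
  unfolding orlicz_function_def ennreal_convex_def lower_semicontinuous_def
proof (intro conjI allI)
  fix x :: ennreal
  show "x \<le> Liminf (at x) (\<lambda>x. x)"
    unfolding le_Liminf_iff by (auto intro: order_tendstoD)
qed (auto simp: tendsto_ident_at)

theorem proposition15:
  fixes M :: "'a measure"
    and \<Phi> :: "'a \<Rightarrow> ennreal \<Rightarrow> ennreal"
    and u :: "'a \<Rightarrow> real"
  assumes "sigma_finite_measure M"
    and "non_atomic M"
    and "musielak_orlicz M \<Phi>"
    and "nonzero_element M \<Phi> u"
    and "K_set M \<Phi> u = {}"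
  shows "smooth_point M \<Phi> u \<longleftrightarrow>
      (modular M (complementary \<Phi>)
           (\<lambda>t. b_fun (complementary \<Phi>) t * indicator (supp M u) t) = 1
         \<and> (AE t in M. a_fun (complementary \<Phi>) t * indicator (space M - supp M u) t = 0))
    \<or> (modular M (complementary \<Phi>) (b_fun (complementary \<Phi>)) < 1
         \<and> emeasure M (space M - supp M u) = 0)"
proof -
  have "AE t in M. orlicz_function (\<Phi> t)"
    using assms(3) unfolding musielak_orlicz_def orlicz_function_def by simp
  then obtain Z where Z: "{t \<in> space M. \<not> orlicz_function (\<Phi> t)} \<subseteq> Z" "Z \<in> null_sets M"
    by (auto elim!: AE_E simp: null_sets_def)
  \<comment> \<open>Changing \<open>\<Phi>\<close> on a null set leaves every modular unchanged.\<close>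
  define \<Xi> where "\<Xi> = (\<lambda>t. if t \<in> space M - Z then \<Phi> t else (\<lambda>x. x))"
  have Phi_meas [measurable]: "(\<lambda>t. \<Phi> t c) \<in> borel_measurable M" for c
    using assms(3) unfolding musielak_orlicz_def by blast
  have [measurable]: "Z \<in> sets M" using Z(2) by auto
  have Xi_meas: "(\<lambda>t. \<Xi> t c) \<in> borel_measurable M" for c
  proof -
    have "(\<lambda>t. if t \<in> space M - Z then \<Phi> t c else c) \<in> borel_measurable M" by measurable
    then show ?thesis unfolding \<Xi>_def by (simp add: if_distribR)
  qed
  have Xi_orlicz: "orlicz_function (\<Xi> t)" for t
    unfolding \<Xi>_def using Z(1) orlicz_function_id by auto
  have ae: "AE t in M. \<Xi> t = \<Phi> t"
    using AE_not_in[OF Z(2)] AE_space by eventually_elim (simp add: \<Xi>_def)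
  \<comment> \<open>The conjugate at \<open>t\<close> depends only on \<open>\<Phi> t\<close>, so it
    inherits the almost everywhere agreement.\<close>
  have ae': "AE t in M. complementary \<Xi> t = complementary \<Phi> t"
    using ae by eventually_elim (simp add: complementary_def fun_eq_iff)
  have modular: "modular M \<Xi> = modular M \<Phi>"
    unfolding modular_def fun_eq_iff
    by (intro allI nn_integral_cong_AE) (use ae in \<open>eventually_elim, simp\<close>)
  have modular': "modular M (complementary \<Xi>) = modular M (complementary \<Phi>)"
    unfolding modular_def fun_eq_iff
    by (intro allI nn_integral_cong_AE) (use ae' in \<open>eventually_elim, simp\<close>)
  have L: "L_space M \<Xi> = L_space M \<Phi>"
    unfolding L_space_def modular_real_def modular ..
  have norm: "orlicz_norm M \<Xi> = orlicz_norm M \<Phi>"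
    unfolding orlicz_norm_def L_class_def modular_real_def modular' ..
  have smooth: "smooth_point M \<Xi> u = smooth_point M \<Phi> u"
    unfolding smooth_point_def nonzero_element_def support_functional_def dual_space_def
      dual_norm_def L norm ..
  have K: "K_set M \<Xi> u = K_set M \<Phi> u"
    unfolding K_set_def amemiya_def modular_real_def modular ..
  \<comment> \<open>All hypotheses carry over because \<open>L_space\<close> and
    \<open>K_set\<close> depend on \<open>\<Phi>\<close> only through its modular.\<close>
  have "norm_not_attained M \<Xi> u"
    using assms Xi_meas Xi_orlicz
    unfolding norm_not_attained_def norm_not_attained_axioms_def musielak_orlicz_space_def
      musielak_orlicz_space_axioms_def nonzero_element_def L K by simp
  then interpret norm_not_attained M \<Xi> u .
  have a: "(AE t in M. a_fun (complementary \<Xi>) t * indicator (space M - supp M u) t = 0)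
      \<longleftrightarrow> (AE t in M. a_fun (complementary \<Phi>) t * indicator (space M - supp M u) t = 0)"
  proof -
    have "AE t in M. a_fun (complementary \<Xi>) t = a_fun (complementary \<Phi>) t"
      using ae' by eventually_elim (simp add: a_fun_def)
    then have "AE t in M. (a_fun (complementary \<Xi>) t * indicator (space M - supp M u) t = 0)
        = (a_fun (complementary \<Phi>) t * indicator (space M - supp M u) t = 0)"
      by eventually_elim simp
    then show ?thesis by (rule eventually_subst)
  qed
  have b1: "modular M (complementary \<Phi>) (\<lambda>t. b_fun (complementary \<Xi>) t * indicator (supp M u) t)
      = modular M (complementary \<Phi>) (\<lambda>t. b_fun (complementary \<Phi>) t * indicator (supp M u) t)"
    unfolding modular_def
    by (rule nn_integral_cong_AE) (use ae' in \<open>eventually_elim, simp add: b_fun_def\<close>)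
  have b2: "modular M (complementary \<Phi>) (b_fun (complementary \<Xi>))
      = modular M (complementary \<Phi>) (b_fun (complementary \<Phi>))"
    unfolding modular_def
    by (rule nn_integral_cong_AE) (use ae' in \<open>eventually_elim, simp add: b_fun_def\<close>)
  show ?thesis using smooth_iff unfolding smooth modular' a b1 b2 .
qed

end
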